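(* The space $\mathcal I$ of local integrals of motion of the quantum discrete sine-Gordon system is a commutative Lie subalgebra of $\mathcal F_0$; that is, $\mathcal I$ is a Lie subalgebra of $(\mathcal F_0,[\cdot,\cdot])$ and $[F,G]=0$ for all $F,G\in\mathcal I$.
   Context: Let $q$ be a formal variable. $A_q$ is the associative algebra over $\mathbb Q[q,q^{-1}]$ generated by $x_i^{\pm1},y_i^{\pm1}$ ($i\in\mathbb Z$; $x_i^{-1},y_i^{-1}$ are inverse to $x_i,y_i$) with relations $$x_kx_l=q\,x_lx_k,\quad y_ky_l=q\,y_ly_k,\quad y_kx_l=q^{-1}x_ly_k\quad(k<l),\qquad x_ky_l=q^{-1}y_lx_k\quad(k\le l).$$ It is graded by $\deg x_i=1$, $\deg y_i=-1$; $A_q[n]$ denotes the degree $n$ part. $T$ is the algebra automorphism $T(x_i)=x_{i+1}$, $T(y_i)=y_{i+1}$. Set $\mathcal F_n=A_q[n]/\mathrm{Im}\big((T-\mathrm{Id})|_{A_q[n]}\big)$ and let $I(P)\in\mathcal F_n$ be the class of $P\in A_q[n]$. For every integer $n$ there is a well defined bilinear bracket $$\mathcal F_0\times\mathcal F_n\to\mathcal F_n,\qquad [I(P),I(Q)]=I\Big(\frac1{q-1}\sum_{i\in\mathbb Z}[T^iP,Q]\Big)$$ (the sum is finite because elements of degree $0$ commute with elements located far away, and commutators in $A_q$ are divisible by $q-1$); for $n=0$ it makes $\mathcal F_0$ a Lie algebra and each $\mathcal F_n$ is an $\mathcal F_0$-module. The screening charges are $\Sigma_+=I(x_0)\in\mathcal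 F_1$ and $\Sigma_-=I(y_0)\in\mathcal F_{-1}$, and $$\mathcal I=\{F\in\mathcal F_0:\ [F,\Sigma_+]=0\text{ and }[F,\Sigma_-]=0\}.$$ *)

theory Defs
  imports Complex_Main "HOL-Library.Poly_Mapping"
begin

section \<open>The ground ring of Laurent polynomials\<close>

text \<open>Finitely supported functions on the integers with the convolution product
  are the Laurent polynomials in one variable.\<close>

type_synonym laurent = "int \<Rightarrow>\<^sub>0 rat"

definition qvar :: laurent where
  "qvar = Poly_Mapping.single 1 1"

definition qinv :: laurent where
  "qinv = Poly_Mapping.single (- 1) 1"

lemma qvar_qinv [simp]: "qvar * qinv = 1" "qinv * qvar = 1"
  by (simp_all add: qvar_def qinv_def mult_single)


section \<open>The free algebra\<close>

text \<open>\<open>Xi k\<close> and \<open>Yi k\<close> are the letters for the inverses of \<open>X k\<close> and \<open>Y k\<close>.\<close>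

datatype gen = X int | Xi int | Y int | Yi int

text \<open>The free monoid is written additively, as the class of monoid algebras
  \<open>'a \<Rightarrow>\<^sub>0 'b\<close> in the library requires.\<close>

datatype word = Word (letters: "gen list")

instantiation word :: monoid_add
begin

definition zero_word :: word where
  "zero_word = Word []"

definition plus_word :: "word \<Rightarrow> word \<Rightarrow> word" where
  "plus_word u v = Word (letters u @ letters v)"

instance
  by standard (simp_all add: zero_word_def plus_word_def)

end

type_synonym falg = "word \<Rightarrow>\<^sub>0 laurent"

definition letter :: "gen \<Rightarrow> falg" where
  "letter g = Poly_Mapping.single (Word [g]) 1"

definition scalar :: "laurent \<Rightarrow> falg" where
  "scalar c = Poly_Mapping.single 0 c"


section \<open>The algebra \<open>A\<^sub>q\<close> by generators and relations\<close>

inductive aq_rel :: "falg \<Rightarrow> falg \<Rightarrow> bool" where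
  X_Xi: "aq_rel (letter (X k) * letter (Xi k)) 1"
| Xi_X: "aq_rel (letter (Xi k) * letter (X k)) 1"
| Y_Yi: "aq_rel (letter (Y k) * letter (Yi k)) 1"
| Yi_Y: "aq_rel (letter (Yi k) * letter (Y k)) 1"
| X_X: "k < l \<Longrightarrow> aq_rel (letter (X k) * letter (X l)) (scalar qvar * (letter (X l) * letter (X k)))"
| Y_Y: "k < l \<Longrightarrow> aq_rel (letter (Y k) * letter (Y l)) (scalar qvar * (letter (Y l) * letter (Y k)))"
| Y_X: "k < l \<Longrightarrow> aq_rel (letter (Y k) * letter (X l)) (scalar qinv * (letter (X l) * letter (Y k)))"
| X_Y: "k \<le> l \<Longrightarrow> aq_rel (letter (X k) * letter (Y l)) (scalar qinv * (letter (Y l) * letter (X k)))"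

inductive_set aq_ideal :: "falg set" where
  zero: "0 \<in> aq_ideal"
| rel: "aq_rel a b \<Longrightarrow> u * (a - b) * v \<in> aq_ideal"
| add: "a \<in> aq_ideal \<Longrightarrow> b \<in> aq_ideal \<Longrightarrow> a + b \<in> aq_ideal"

lemma aq_ideal_mult_left: "a \<in> aq_ideal \<Longrightarrow> c * a \<in> aq_ideal"
proof (induction rule: aq_ideal.induct)
  case (rel a b u v)
  then show ?case using aq_ideal.rel[of a b "c * u" v] by (simp add: mult.assoc)
qed (auto simp: distrib_left intro: aq_ideal.intros)

lemma aq_ideal_mult_right: "a \<in> aq_ideal \<Longrightarrow> a * c \<in> aq_ideal"
proof (induction rule: aq_ideal.induct)
  case (rel a b u v)
  then show ?case using aq_ideal.rel[of a b u "v * c"] by (simp add: mult.assoc)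
qed (auto simp: distrib_right intro: aq_ideal.intros)

lemma aq_ideal_minus: "a \<in> aq_ideal \<Longrightarrow> - a \<in> aq_ideal"
  using aq_ideal_mult_left[of a "- 1"] by simp

lemma aq_ideal_diff: "a \<in> aq_ideal \<Longrightarrow> b \<in> aq_ideal \<Longrightarrow> a - b \<in> aq_ideal"
  using aq_ideal.add[OF _ aq_ideal_minus, of a b] by simp

lemma aq_ideal_rel: "aq_rel a b \<Longrightarrow> a - b \<in> aq_ideal"
  using aq_ideal.rel[of a b 1 1] by simp

definition aq_eq :: "falg \<Rightarrow> falg \<Rightarrow> bool" where
  "aq_eq a b \<longleftrightarrow> a - b \<in> aq_ideal"

lemma equivp_aq_eq: "equivp aq_eq"
proof (rule equivpI)
  show "reflp aq_eq"
    by (simp add: reflp_def aq_eq_def aq_ideal.zero)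
  show "symp aq_eq"
    unfolding symp_def aq_eq_def using aq_ideal_minus by fastforce
  show "transp aq_eq"
  proof (rule transpI)
    fix a b c assume "aq_eq a b" "aq_eq b c"
    then have "(a - b) + (b - c) \<in> aq_ideal"
      unfolding aq_eq_def by (rule aq_ideal.add)
    then show "aq_eq a c" by (simp add: aq_eq_def)
  qed
qed

quotient_type aq = falg / aq_eq
  by (rule equivp_aq_eq)

lemma aq_eq_mult: "aq_eq a a' \<Longrightarrow> aq_eq b b' \<Longrightarrow> aq_eq (a * b) (a' * b')"
proof -
  assume "aq_eq a a'" "aq_eq b b'"
  then have "(a - a') * b + a' * (b - b') \<in> aq_ideal"
    unfolding aq_eq_def by (intro aq_ideal.add aq_ideal_mult_left aq_ideal_mult_right)
  then show ?thesis by (simp add: aq_eq_def algebra_simps)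
qed

text \<open>The augmentation sending all generators and the variable to 1 shows that the
  quotient is not the zero ring.\<close>

definition aug :: "('b::zero \<Rightarrow> 'c::comm_ring_1) \<Rightarrow> ('a \<Rightarrow>\<^sub>0 'b) \<Rightarrow> 'c" where
  "aug h p = (\<Sum>k\<in>Poly_Mapping.keys p. h (Poly_Mapping.lookup p k))"

lemma aug_superset:
  assumes "h 0 = 0" "finite S" "Poly_Mapping.keys p \<subseteq> S"
  shows "aug h p = (\<Sum>k\<in>S. h (Poly_Mapping.lookup p k))"
  unfolding aug_def using assms
  by (intro sum.mono_neutral_left) (auto simp: in_keys_iff)

lemma aug_add:
  assumes "h 0 = 0" "\<And>a b. h (a + b) = h a + h b"
  shows "aug h (p + r) = aug h p + aug h (r :: 'a \<Rightarrow>\<^sub>0 'b::comm_ring_1)"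
proof -
  let ?S = "Poly_Mapping.keys p \<union> Poly_Mapping.keys r"
  have "aug h (p + r) = (\<Sum>k\<in>?S. h (Poly_Mapping.lookup (p + r) k))"
    using Poly_Mapping.keys_add[of p r] by (intro aug_superset) (auto simp: assms)
  also have "\<dots> = (\<Sum>k\<in>?S. h (Poly_Mapping.lookup p k)) + (\<Sum>k\<in>?S. h (Poly_Mapping.lookup r k))"
    by (simp add: lookup_add assms sum.distrib)
  also have "\<dots> = aug h p + aug h r"
    by (simp add: aug_superset[where S = ?S] assms)
  finally show ?thesis .
qed

lemma aug_single: "h 0 = 0 \<Longrightarrow> aug h (Poly_Mapping.single k c) = h c"
  by (simp add: aug_def)

lemma poly_mapping_single_induct:
  assumes "P 0" "\<And>k c. P (Poly_Mapping.single k c)" "\<And>a b. P a \<Longrightarrow> P b \<Longrightarrow> P (a + b)"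
  shows "P (p :: 'a \<Rightarrow>\<^sub>0 'b::comm_monoid_add)"
proof -
  have eq: "p = (\<Sum>k\<in>Poly_Mapping.keys p. Poly_Mapping.single k (Poly_Mapping.lookup p k))"
    by (rule poly_mapping_eqI)
       (simp add: lookup_sum lookup_single when_def in_keys_iff)
  have "P (\<Sum>k\<in>S. Poly_Mapping.single k (Poly_Mapping.lookup p k))" if "finite S" for S
    using that by induction (auto intro: assms)
  then show ?thesis by (subst eq) simp
qed

lemma additive_mult_extend:
  fixes f :: "('a::monoid_add \<Rightarrow>\<^sub>0 'b::comm_ring_1) \<Rightarrow> 'c::ring"
  assumes add: "\<And>a b. f (a + b) = f a + f b"
    and single: "\<And>k c l d. f (Poly_Mapping.single k c * Poly_Mapping.single l d) =
      f (Poly_Mapping.single k c) * f (Poly_Mapping.single l d)"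
  shows "f (a * b) = f a * f b"
proof -
  have zero: "f 0 = 0" using add[of 0 0] by simp
  have 1: "f (Poly_Mapping.single k c * b) = f (Poly_Mapping.single k c) * f b" for k c b
    by (induction b rule: poly_mapping_single_induct) (simp_all add: zero add single distrib_left)
  show ?thesis
    by (induction a rule: poly_mapping_single_induct) (simp_all add: zero add 1 distrib_right)
qed

lemma aug_mult:
  assumes "h 0 = 0" "\<And>a b. h (a + b) = h a + h b" "\<And>a b. h (a * b) = h a * h b"
  shows "aug h (p * r) = aug h p * aug h (r :: 'a::monoid_add \<Rightarrow>\<^sub>0 'b::comm_ring_1)"
  by (rule additive_mult_extend)
     (simp_all add: aug_add aug_single mult_single assms)

definition falg_aug :: "falg \<Rightarrow> rat" where
  "falg_aug = aug (aug (\<lambda>c. c))"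

lemma aug_laurent:
  "aug (\<lambda>c. c) (0::laurent) = (0::rat)"
  "aug (\<lambda>c. c) (a + b :: laurent) = aug (\<lambda>c. c) a + (aug (\<lambda>c. c) b :: rat)"
  "aug (\<lambda>c. c) (a * b :: laurent) = aug (\<lambda>c. c) a * (aug (\<lambda>c. c) b :: rat)"
  by (simp_all add: aug_add aug_mult) (simp add: aug_def)

lemma falg_aug_add: "falg_aug (a + b) = falg_aug a + falg_aug b"
  unfolding falg_aug_def by (rule aug_add) (simp_all add: aug_laurent)

lemma falg_aug_mult: "falg_aug (a * b) = falg_aug a * falg_aug b"
  unfolding falg_aug_def by (rule aug_mult) (simp_all add: aug_laurent)

lemma falg_aug_single:
  "falg_aug (Poly_Mapping.single w (Poly_Mapping.single j c)) = c"
  unfolding falg_aug_def by (simp add: aug_single aug_laurent)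

lemma falg_aug_basic:
  "falg_aug 0 = 0" "falg_aug 1 = 1" "falg_aug (letter g) = 1"
  "falg_aug (scalar qvar) = 1" "falg_aug (scalar qinv) = 1"
proof -
  show "falg_aug 0 = 0" using falg_aug_add[of 0 0] by simp
  show "falg_aug 1 = 1" using falg_aug_single[of 0 0 1] by simp
  show "falg_aug (letter g) = 1" using falg_aug_single[of _ 0 1] by (simp add: letter_def)
  show "falg_aug (scalar qvar) = 1" "falg_aug (scalar qinv) = 1"
    by (simp_all add: scalar_def qvar_def qinv_def falg_aug_single)
qed

lemma falg_aug_ideal: "a \<in> aq_ideal \<Longrightarrow> falg_aug a = 0"
proof (induction rule: aq_ideal.induct)
  case (rel a b u v)
  have "falg_aug a = falg_aug b"
    using rel by cases (simp_all add: falg_aug_mult falg_aug_basic)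
  then have "falg_aug (a - b) = 0"
    using falg_aug_add[of "a - b" b] by simp
  then show ?case by (simp add: falg_aug_mult)
qed (simp_all add: falg_aug_basic falg_aug_add)

instantiation aq :: ring_1
begin

lift_definition zero_aq :: aq is 0 .

lift_definition one_aq :: aq is 1 .

lift_definition plus_aq :: "aq \<Rightarrow> aq \<Rightarrow> aq" is "(+)"
  unfolding aq_eq_def by (metis add_diff_add aq_ideal.add)

lift_definition uminus_aq :: "aq \<Rightarrow> aq" is uminus
  unfolding aq_eq_def using aq_ideal_minus by fastforce

lift_definition minus_aq :: "aq \<Rightarrow> aq \<Rightarrow> aq" is "(-)"
proof -
  fix a a' b b' :: falg
  assume "aq_eq a a'" "aq_eq b b'"
  then have "(a - a') - (b - b') \<in> aq_ideal"
    unfolding aq_eq_def by (rule aq_ideal_diff)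
  then show "aq_eq (a - b) (a' - b')" by (simp add: aq_eq_def algebra_simps)
qed

lift_definition times_aq :: "aq \<Rightarrow> aq \<Rightarrow> aq" is "(*)"
  by (rule aq_eq_mult)

instance
proof
  show "(0::aq) \<noteq> 1"
  proof (transfer, rule notI)
    assume "aq_eq 0 1"
    then have "falg_aug (0 - 1) = 0" unfolding aq_eq_def by (rule falg_aug_ideal)
    then show False using falg_aug_add[of "0 - 1" 1] by (simp add: falg_aug_basic)
  qed
qed (transfer; simp add: aq_eq_def aq_ideal.zero algebra_simps)+

end

lift_definition smult_aq :: "laurent \<Rightarrow> aq \<Rightarrow> aq" (infixr "*\<^sub>q" 75)
  is "\<lambda>c a. scalar c * a"
  by (rule aq_eq_mult) (simp_all add: aq_eq_def aq_ideal.zero)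

interpretation aq: module smult_aq
  by standard
     (transfer; simp add: aq_eq_def aq_ideal.zero scalar_def algebra_simps single_add
        mult_single flip: mult.assoc)+

lemma scalar_commute: "scalar c * a = a * scalar c"
  unfolding scalar_def
  by (induction a rule: poly_mapping_single_induct)
     (simp_all add: mult_single distrib_left distrib_right mult.commute)

lemma smult_aq_mult: "(c *\<^sub>q a) * b = c *\<^sub>q (a * b)" "a * (c *\<^sub>q b) = c *\<^sub>q (a * b)"
  by (transfer, simp add: aq_eq_def aq_ideal.zero mult.assoc)
     (transfer, metis aq_eq_def aq_ideal.zero diff_self mult.assoc scalar_commute)

lift_definition word_aq :: "word \<Rightarrow> aq" is "\<lambda>w. Poly_Mapping.single w 1" .

definition xg :: "int \<Rightarrow> aq" where
  "xg k = word_aq (Word [X k])"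

definition yg :: "int \<Rightarrow> aq" where
  "yg k = word_aq (Word [Y k])"


section \<open>Grading\<close>

fun gen_deg :: "gen \<Rightarrow> int" where
  "gen_deg (X k) = 1"
| "gen_deg (Xi k) = - 1"
| "gen_deg (Y k) = - 1"
| "gen_deg (Yi k) = 1"

definition word_deg :: "word \<Rightarrow> int" where
  "word_deg w = (\<Sum>g\<leftarrow>letters w. gen_deg g)"

definition aq_deg :: "int \<Rightarrow> aq set" where
  "aq_deg n = aq.span {word_aq w |w. word_deg w = n}"


section \<open>The shift automorphism\<close>

fun shift_gen :: "int \<Rightarrow> gen \<Rightarrow> gen" where
  "shift_gen i (X k) = X (k + i)"
| "shift_gen i (Xi k) = Xi (k + i)"
| "shift_gen i (Y k) = Y (k + i)"
| "shift_gen i (Yi k) = Yi (k + i)"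

definition shift_word :: "int \<Rightarrow> word \<Rightarrow> word" where
  "shift_word i w = Word (map (shift_gen i) (letters w))"

lemma shift_gen_shift_gen: "shift_gen i (shift_gen j g) = shift_gen (i + j) g"
  by (cases g) simp_all

lemma shift_gen_0: "shift_gen 0 g = g"
  by (cases g) simp_all

lemma shift_word_shift_word: "shift_word i (shift_word j w) = shift_word (i + j) w"
  by (simp add: shift_word_def shift_gen_shift_gen)

lemma shift_word_0: "shift_word 0 w = w"
  by (simp add: shift_word_def shift_gen_0[abs_def])

lemma shift_word_zero: "shift_word i 0 = 0"
  by (simp add: shift_word_def zero_word_def)

lemma shift_word_plus: "shift_word i (u + v) = shift_word i u + shift_word i v"
  by (simp add: shift_word_def plus_word_def)

lemma inj_shift_word: "inj (shift_word i)"
  by (rule inj_on_inverseI[of _ "shift_word (- i)"]) (simp add: shift_word_shift_word shift_word_0)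

text \<open>\<open>map_key\<close> is precomposition, so pushing words forward by \<open>i\<close> needs \<open>- i\<close>.\<close>

definition shift_falg :: "int \<Rightarrow> falg \<Rightarrow> falg" where
  "shift_falg i = Poly_Mapping.map_key (shift_word (- i))"

lemma shift_falg_single:
  "shift_falg i (Poly_Mapping.single w c) = Poly_Mapping.single (shift_word i w) c"
  using map_key_single[OF inj_shift_word, of "- i" "shift_word i w" c]
  by (simp add: shift_falg_def shift_word_shift_word shift_word_0)

lemma shift_falg_add: "shift_falg i (a + b) = shift_falg i a + shift_falg i b"
  by (simp add: shift_falg_def map_key_plus[OF inj_shift_word])

lemma shift_falg_zero: "shift_falg i 0 = 0"
  by (simp add: shift_falg_def map_key_zero[OF inj_shift_word])

lemma shift_falg_diff: "shift_falg i (a - b) = shift_falg i a - shift_falg i b"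
  using shift_falg_add[of i "a - b" b] by simp

lemma shift_falg_mult: "shift_falg i (a * b) = shift_falg i a * shift_falg i b"
  by (rule additive_mult_extend)
     (simp_all add: shift_falg_add shift_falg_single mult_single shift_word_plus)

lemma shift_falg_basic:
  "shift_falg i 1 = 1" "shift_falg i (scalar c) = scalar c"
  "shift_falg i (letter g) = letter (shift_gen i g)"
  using shift_falg_single[of i 0 1]
  by (simp_all add: shift_falg_single scalar_def letter_def shift_word_zero)
     (simp add: shift_word_def)

lemma shift_falg_shift_falg: "shift_falg i (shift_falg j a) = shift_falg (i + j) a"
  by (induction a rule: poly_mapping_single_induct)
     (simp_all add: shift_falg_zero shift_falg_single shift_falg_add shift_word_shift_word)

lemma shift_falg_0: "shift_falg 0 a = a"
  by (induction a rule: poly_mapping_single_induct)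
     (simp_all add: shift_falg_zero shift_falg_single shift_falg_add shift_word_0)

lemma aq_rel_shift: "aq_rel a b \<Longrightarrow> aq_rel (shift_falg i a) (shift_falg i b)"
  by (induction rule: aq_rel.induct)
     (auto simp: shift_falg_mult shift_falg_basic intro: aq_rel.intros)

lemma aq_ideal_shift: "a \<in> aq_ideal \<Longrightarrow> shift_falg i a \<in> aq_ideal"
  by (induction rule: aq_ideal.induct)
     (auto simp: shift_falg_zero shift_falg_mult shift_falg_diff shift_falg_add
       intro: aq_ideal.intros aq_rel_shift)

text \<open>\<open>shift i\<close> is the \<open>i\<close>-th power of the automorphism \<open>T = shift 1\<close>.\<close>

lift_definition shift :: "int \<Rightarrow> aq \<Rightarrow> aq" is shift_falg
  by (simp add: aq_eq_def aq_ideal_shift flip: shift_falg_diff)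

lemma shift_shift: "shift i (shift j a) = shift (i + j) a"
  by transfer (simp add: shift_falg_shift_falg aq_eq_def aq_ideal.zero)

lemma shift_0: "shift 0 a = a"
  by transfer (simp add: shift_falg_0 aq_eq_def aq_ideal.zero)

lemma shift_add: "shift i (a + b) = shift i a + shift i b"
  by transfer (simp add: shift_falg_add aq_eq_def aq_ideal.zero)

lemma shift_mult: "shift i (a * b) = shift i a * shift i b"
  by transfer (simp add: shift_falg_mult aq_eq_def aq_ideal.zero)

lemma shift_1: "shift i 1 = 1"
  by transfer (simp add: shift_falg_basic aq_eq_def aq_ideal.zero)

lemma shift_smult: "shift i (c *\<^sub>q a) = c *\<^sub>q shift i a"
  by transfer (simp add: shift_falg_mult shift_falg_basic aq_eq_def aq_ideal.zero)

lemma shift_word_aq: "shift i (word_aq w) = word_aq (shift_word i w)"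
  by transfer (simp add: shift_falg_single aq_eq_def aq_ideal.zero)

lemma shift_xg: "shift i (xg k) = xg (k + i)"
  by (simp add: xg_def shift_word_aq shift_word_def)

lemma shift_yg: "shift i (yg k) = yg (k + i)"
  by (simp add: yg_def shift_word_aq shift_word_def)

lemma shift_diff: "shift i (a - b) = shift i a - shift i b"
  using shift_add[of i "a - b" b] by simp


section \<open>Local functionals\<close>

definition shift_rel :: "int \<Rightarrow> (aq \<times> aq) set" where
  "shift_rel n = {(P, Q). P \<in> aq_deg n \<and> Q \<in> aq_deg n \<and>
     P - Q \<in> (\<lambda>R. shift 1 R - R) ` aq_deg n}"

lemma equiv_shift_rel: "equiv (aq_deg n) (shift_rel n)"
proof (rule equivI)
  have D: "aq.subspace (aq_deg n)"
    unfolding aq_deg_def by (rule aq.subspace_span)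
  show "shift_rel n \<subseteq> aq_deg n \<times> aq_deg n"
    by (auto simp: shift_rel_def)
  show "refl_on (aq_deg n) (shift_rel n)"
  proof (rule refl_onI)
    fix P assume "P \<in> aq_deg n"
    then show "(P, P) \<in> shift_rel n"
      using aq.subspace_0[OF D] shift_diff[of 1 0 0]
      by (auto simp: shift_rel_def intro!: image_eqI[of _ _ 0])
  qed
  show "sym (shift_rel n)"
  proof (rule symI)
    fix P Q assume "(P, Q) \<in> shift_rel n"
    then obtain R where R: "P \<in> aq_deg n" "Q \<in> aq_deg n" "R \<in> aq_deg n" "P - Q = shift 1 R - R"
      by (auto simp: shift_rel_def)
    have "shift 1 (- R) = - shift 1 R"
      using shift_diff[of 1 0 R] shift_diff[of 1 0 0] by simp
    moreover have "Q - P = - (P - Q)" by simp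
    ultimately have "Q - P = shift 1 (- R) - (- R)"
      unfolding R(4) by simp
    then have "Q - P \<in> (\<lambda>R. shift 1 R - R) ` aq_deg n"
      by (rule image_eqI) (rule aq.subspace_neg[OF D R(3)])
    then show "(Q, P) \<in> shift_rel n"
      using R by (auto simp: shift_rel_def)
  qed
  show "trans (shift_rel n)"
  proof (rule transI)
    fix P Q S assume "(P, Q) \<in> shift_rel n" "(Q, S) \<in> shift_rel n"
    then obtain R R' where R: "P \<in> aq_deg n" "S \<in> aq_deg n" "R \<in> aq_deg n" "R' \<in> aq_deg n"
      "P - Q = shift 1 R - R" "Q - S = shift 1 R' - R'"
      by (auto simp: shift_rel_def)
    have "P - S = (P - Q) + (Q - S)" by simp
    also have "\<dots> = shift 1 (R + R') - (R + R')"
      unfolding R shift_add by (simp add: algebra_simps)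
    finally show "(P, S) \<in> shift_rel n"
      using R aq.subspace_add[OF D R(3,4)] by (auto simp: shift_rel_def)
  qed
qed

definition Floc :: "int \<Rightarrow> aq set set" where
  "Floc n = aq_deg n // shift_rel n"

definition cls :: "int \<Rightarrow> aq \<Rightarrow> aq set" where
  "cls n P = shift_rel n `` {P}"

text \<open>Operations on the quotients are given on representatives. The union over all
  representatives is a class because the result does not depend on their choice.\<close>

definition add_Floc :: "int \<Rightarrow> aq set \<Rightarrow> aq set \<Rightarrow> aq set" where
  "add_Floc n U V = (\<Union>P\<in>U. \<Union>Q\<in>V. cls n (P + Q))"

definition smult_Floc :: "int \<Rightarrow> laurent \<Rightarrow> aq set \<Rightarrow> aq set" where
  "smult_Floc n c U = (\<Union>P\<in>U. cls n (c *\<^sub>q P))"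

text \<open>For \<open>P\<close> of degree 0 all but finitely many commutators in the sum vanish,
  and the sum is divisible by \<open>q - 1\<close>. The quotient is unique since
  \<open>A\<^sub>q\<close> is torsion-free.\<close>

definition bracket_rep :: "aq \<Rightarrow> aq \<Rightarrow> aq" where
  "bracket_rep P Q =
     (THE R. (qvar - 1) *\<^sub>q R = Sum_any (\<lambda>i::int. shift i P * Q - Q * shift i P))"

definition bracket :: "int \<Rightarrow> aq set \<Rightarrow> aq set \<Rightarrow> aq set" where
  "bracket n U V = (\<Union>P\<in>U. \<Union>Q\<in>V. cls n (bracket_rep P Q))"


section \<open>Local integrals of motion\<close>

definition screening_plus :: "aq set" where
  "screening_plus = cls 1 (xg 0)"

definition screening_minus :: "aq set" where
  "screening_minus = cls (- 1) (yg 0)"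

definition local_ims :: "aq set set" where
  "local_ims = {U \<in> Floc 0. bracket 1 U screening_plus = cls 1 0 \<and>
     bracket (- 1) U screening_minus = cls (- 1) 0}"

definition lie_subalgebra :: "aq set set \<Rightarrow> bool" where
  "lie_subalgebra S \<longleftrightarrow> S \<subseteq> Floc 0 \<and> cls 0 0 \<in> S \<and>
     (\<forall>U\<in>S. \<forall>V\<in>S. add_Floc 0 U V \<in> S) \<and>
     (\<forall>c. \<forall>U\<in>S. smult_Floc 0 c U \<in> S) \<and>
     (\<forall>U\<in>S. \<forall>V\<in>S. bracket 0 U V \<in> S)"

end

theory Submission
  imports Defs "HOL-Library.Function_Algebras"
begin

text \<open>Put \<open>z\<^bsub>2k\<^esub> = x\<^sub>k\<close>, \<open>z\<^bsub>2k+1\<^esub> = y\<^sub>k\<close> and \<open>v\<^sub>a = z\<^sub>a\<^sup>-\<^sup>1 z\<^bsub>a+1\<^esub>\<^sup>-\<^sup>1\<close>. The monomials in the \<open>v\<^sub>a\<close> form a basis of the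
  degree 0 part, and a class in degree 0 is determined by the sums of the coefficients over the shift
  orbits of monomials, together with the constant term. For an integral of motion, the two screening
  conditions are linear recurrences for the orbit sums. They force the exponents of all monomials that
  occur to be nonnegative with connected support, they force some product
  \<open>v\<^sub>l v\<^bsub>l+1\<^esub> \<dots> v\<^sub>r\<close> of consecutive elements to occur unless all orbit sums vanish, and they
  make the coefficient of such a product depend on \<open>r - l\<close> only.

  The bracket of two integrals is an integral by the Jacobi identity. In its coefficient at
  \<open>v\<^sub>l v\<^bsub>l+1\<^esub> \<dots> v\<^sub>r\<close> only splittings into a prefix and a suffix contribute, and they cancel in pairs.
  Hence all orbit sums of the bracket vanish.\<close>

section \<open>Powers of \<open>q\<close> and extremal choices\<close>

text \<open>The equation read at \<open>p + zexp b\<close> relates the orbit sum at \<open>p\<close>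
  only to orbit sums at exponents that differ from \<open>p\<close> by an alternating string of 1
  and -1, and every such string lowers entry \<open>b - 1\<close> or entry \<open>b\<close> by one.
  If \<open>p\<close> is chosen extremal in a suitable sense, all other terms are excluded and the
  equation collapses to \<open>gam b p = 0\<close>, that is, \<open>p b = p (b - 1)\<close>.
  Nonnegativity, connectedness and the occurrence of a block all come from propagating this equality
  along neighbouring entries.

  The coefficients of a bracket at arbitrary monomials are out of reach. That the bracket is again
  an integral is what reduces the computation to consecutive products.

  The constant term is fixed by the shift and escapes the orbit sums, so it is checked separately.
  Division by \<open>q - 1\<close> is postponed: the computations use \<open>flow\<close>, which is
  \<open>q - 1\<close> times the bracket, and cancel the factor at the end because the algebra is
  torsion-free.\<close>

definition qpow :: "int \<Rightarrow> laurent" where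
  "qpow k = Poly_Mapping.single k 1"

lemma qpow_add: "qpow (j + k) = qpow j * qpow k"
  by (simp add: qpow_def mult_single)

lemma qpow_0 [simp]: "qpow 0 = 1"
  by (simp add: qpow_def)

lemma qpow_inject [simp]: "qpow j = qpow k \<longleftrightarrow> j = k"
  unfolding qpow_def by (metis lookup_single_eq lookup_single_not_eq zero_neq_one)

lemma qpow_eq_1_iff [simp]: "qpow k = 1 \<longleftrightarrow> k = 0" "1 = qpow k \<longleftrightarrow> k = 0"
  using qpow_inject[of k 0] qpow_inject[of 0 k] unfolding qpow_0 by auto

lemma qvar_qpow: "qvar = qpow 1" "qinv = qpow (- 1)"
  by (simp_all add: qvar_def qinv_def qpow_def)

lemma int_valued_minimizer:
  fixes f :: "'a \<Rightarrow> int"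
  assumes "\<exists>x. P x" "\<And>y. P y \<Longrightarrow> N \<le> f y"
  shows "\<exists>y. P y \<and> (\<forall>z. P z \<longrightarrow> f y \<le> f z)"
proof -
  obtain y where y: "P y" "\<And>z. P z \<Longrightarrow> nat (f y - N) \<le> nat (f z - N)"
    using ex_has_least_nat[of P _ "\<lambda>y. nat (f y - N)"] assms(1) by blast
  have "f y \<le> f z" if "P z" for z
    using y(2)[OF that] assms(2)[OF y(1)] assms(2)[OF that] by linarith
  then show ?thesis using y(1) by blast
qed

lemma int_valued_maximizer:
  fixes f :: "'a \<Rightarrow> int"
  assumes "\<exists>x. P x" "\<And>y. P y \<Longrightarrow> f y \<le> N"
  shows "\<exists>y. P y \<and> (\<forall>z. P z \<longrightarrow> f z \<le> f y)"
  using int_valued_minimizer[of P "- N" "\<lambda>y. - f y"] assms by auto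

section \<open>Densities annihilated by the screening charges\<close>

text \<open>Write \<open>z\<^bsub>2k\<^esub> = x\<^sub>k\<close> and \<open>z\<^bsub>2k+1\<^esub> = y\<^sub>k\<close>. A monomial with exponent \<open>\<mu>\<^sub>a\<close> at \<open>z\<^sub>a\<close> is encoded by
  the function \<open>p\<close> that vanishes far to the left and satisfies \<open>\<mu>\<^sub>a = - (p\<^sub>a + p\<^bsub>a-1\<^esub>)\<close>. It has degree
  0 iff \<open>p\<close> has finite support, and then \<open>p\<close> lists the exponents of the elements
  \<open>z\<^sub>a\<^sup>-\<^sup>1 z\<^bsub>a+1\<^esub>\<^sup>-\<^sup>1\<close>. The generator \<open>z\<^sub>b\<close> itself is encoded by \<open>zexp b\<close>.\<close>

definition zexp :: "int \<Rightarrow> int \<Rightarrow> int" where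
  "zexp b x = (if x < b then 0 else if even (x - b) then - 1 else 1)"

text \<open>For \<open>c < b\<close> of equal parity, \<open>z_b\<close> times the inverse of
  \<open>z_c\<close> is, up to a power of \<open>q\<close>, the alternating product of
  \<open>v_c, ..., v_(b-1)\<close>. The string has even length, starts with 1 at \<open>c\<close>
  and ends with -1 at \<open>b - 1\<close>; in \<open>zexp_move_up\<close> it starts with -1 at
  \<open>b\<close> and ends with 1 at \<open>c - 1\<close>.\<close>

lemma zexp_move_down:
  "c < b \<Longrightarrow> even (c - b) \<Longrightarrow> (p + zexp b - zexp c) x =
    p x + (if c \<le> x \<and> x < b then if even (x - c) then 1 else - 1 else 0)"
  by (auto simp: zexp_def)

lemma zexp_move_up:
  "b < c \<Longrightarrow> even (c - b) \<Longrightarrow> (p + zexp b - zexp c) x =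
    p x + (if b \<le> x \<and> x < c then if even (x - b) then - 1 else 1 else 0)"
  by (auto simp: zexp_def)

text \<open>The commutator of the monomial of exponent \<open>p\<close>, of degree 0, with \<open>z\<^sub>b\<close> has coefficient \<open>gam b p\<close>.\<close>

definition gam :: "int \<Rightarrow> (int \<Rightarrow> int) \<Rightarrow> laurent" where
  "gam b p = qpow (- p b) - qpow (- p (b - 1))"

definition block :: "int \<Rightarrow> int \<Rightarrow> int \<Rightarrow> int" where
  "block l r x = (if l \<le> x \<and> x \<le> r then 1 else 0)"

text \<open>\<open>h p\<close> is the coefficient of the monomial \<open>p\<close> in the formal sum of all translates of a density.
  The last assumption says that this sum commutes with the sum of all \<open>z\<^bsub>b+2j\<^esub>\<close>; it is read at the
  monomial of exponent \<open>p + zexp b\<close>.\<close>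

locale screened_density =
  fixes h :: "(int \<Rightarrow> int) \<Rightarrow> laurent"
  assumes bounded_below: "\<exists>N. \<forall>p a. h p \<noteq> 0 \<longrightarrow> N \<le> p a"
    and bounded_width: "\<exists>W. \<forall>p a b. h p \<noteq> 0 \<longrightarrow> p a \<noteq> 0 \<longrightarrow> p b \<noteq> 0 \<longrightarrow> b - a \<le> W"
    and zero_exponent: "h 0 = 0"
    and finite_exponent: "h p \<noteq> 0 \<Longrightarrow> finite {a. p a \<noteq> 0}"
    and screened: "finite {a. p a \<noteq> 0} \<Longrightarrow>
      Sum_any (\<lambda>j. h (p + zexp b - zexp (b + 2 * j)) * gam (b + 2 * j) (p + zexp b - zexp (b + 2 * j))) = 0"
begin

lemma two_terms:
  assumes "finite {a. p a \<noteq> 0}" "even (c - b)" "c \<noteq> b"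
    and "\<And>d. even (d - b) \<Longrightarrow> d \<noteq> b \<Longrightarrow> d \<noteq> c \<Longrightarrow> h (p + zexp b - zexp d) = 0"
  shows "h p * gam b p = - (h (p + zexp b - zexp c) * gam c (p + zexp b - zexp c))"
proof -
  let ?f = "\<lambda>j. h (p + zexp b - zexp (b + 2 * j)) * gam (b + 2 * j) (p + zexp b - zexp (b + 2 * j))"
  obtain i where i: "c = b + 2 * i" using assms(2)
    by (metis add.commute diff_add_cancel dvdE)
  have "Sum_any ?f = sum ?f {0, i}"
  proof (rule Sum_any.expand_superset)
    show "{j. ?f j \<noteq> 0} \<subseteq> {0, i}"
    proof
      fix j assume "j \<in> {j. ?f j \<noteq> 0}"
      then have "b + 2 * j = b \<or> b + 2 * j = c"
        using assms(4)[of "b + 2 * j"] by auto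
      then show "j \<in> {0, i}" using i by auto
    qed
  qed simp
  then have "h p * gam b p + h (p + zexp b - zexp c) * gam c (p + zexp b - zexp c) = 0"
    using screened[OF assms(1), of b] assms(3) i by auto
  then show ?thesis by (simp add: eq_neg_iff_add_eq_0)
qed

text \<open>This is how extremality is used: Laurent polynomials have no zero divisors and distinct
  powers of \<open>q\<close> differ, so a lone term forces two equal neighbouring entries.\<close>

lemma single_term:
  assumes "h p \<noteq> 0"
    and "\<And>c. even (c - b) \<Longrightarrow> c \<noteq> b \<Longrightarrow> h (p + zexp b - zexp c) = 0"
  shows "p b = p (b - 1)"
proof -
  \<comment> \<open>The choice \<open>b + 2\<close> of the second index is arbitrary: its term
    vanishes as well.\<close>
  have "h p * gam b p = 0"
    using two_terms[OF finite_exponent[OF assms(1)], of "b + 2" b] assms(2) by simp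
  then show ?thesis using assms(1) by (simp add: gam_def)
qed

text \<open>A negative minimal value of the exponents propagates to the right without end: among the
  exponents with this value on an interval, one with the least next entry makes all other terms of
  the screening equation vanish.\<close>

lemma nonneg:
  assumes "h p \<noteq> 0"
  shows "0 \<le> p a"
proof (rule ccontr)
  assume neg: "\<not> 0 \<le> p a"
  obtain N where N: "\<And>p a. h p \<noteq> 0 \<Longrightarrow> N \<le> p a" using bounded_below by blast
  obtain W where W: "\<And>p a b. h p \<noteq> 0 \<Longrightarrow> p a \<noteq> 0 \<Longrightarrow> p b \<noteq> 0 \<Longrightarrow> b - a \<le> W"
    using bounded_width by blast
  \<comment> \<open>A pair consists of an exponent and a position, so the minimum is over all
    entries of all occurring exponents.\<close>
  have "\<exists>y. h (fst y) \<noteq> 0 \<and> (\<forall>z. h (fst z) \<noteq> 0 \<longrightarrow> fst y (snd y) \<le> fst z (snd z))"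
    by (rule int_valued_minimizer[where N = N]) (use assms N in auto)
  then obtain y where y: "h (fst y) \<noteq> 0"
    "\<And>z. h (fst z) \<noteq> 0 \<Longrightarrow> fst y (snd y) \<le> fst z (snd z)"
    by blast
  obtain p0 a0 where y0: "y = (p0, a0)" by (cases y)
  define m where "m = p0 a0"
  have m_le: "m \<le> p' x" if "h p' \<noteq> 0" for p' x
    using y(2)[of "(p', x)"] that y0 m_def by simp
  have "m < 0" using m_le[OF assms, of a] neg by simp
  \<comment> \<open>Arbitrarily long runs of the value \<open>m\<close> are built; since
    \<open>m\<close> is nonzero, a run longer than \<open>W\<close> contradicts the bounded
    width.\<close>
  have "\<exists>p. h p \<noteq> 0 \<and> (\<forall>x\<in>{a0..a0 + int n}. p x = m)" for n
  proof (induction n)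
    case 0
    then show ?case using y y0 m_def by auto
  next
    case (Suc n)
    define b where "b = a0 + int n + 1"
    let ?E = "\<lambda>p. h p \<noteq> 0 \<and> (\<forall>x\<in>{a0..a0 + int n}. p x = m)"
    have "\<exists>p. ?E p \<and> (\<forall>p'. ?E p' \<longrightarrow> p b \<le> p' b)"
      by (rule int_valued_minimizer[where N = N]) (use Suc N in blast)+
    then obtain p where p: "?E p" and least: "\<And>p'. ?E p' \<Longrightarrow> p b \<le> p' b"
      by blast
    have "p b = p (b - 1)"
    proof (rule single_term)
      fix c assume c: "even (c - b)" "c \<noteq> b"
      let ?p' = "p + zexp b - zexp c"
      show "h ?p' = 0"
      proof (rule ccontr)
        assume h': "h ?p' \<noteq> 0"
        show False
        \<comment> \<open>For \<open>c < b\<close> the entry at \<open>b - 1\<close> would drop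
          below the minimum \<open>m\<close>. For \<open>c > b\<close> the run is untouched and the
          entry at \<open>b\<close> drops, against the choice of \<open>p\<close>.\<close>
        proof (cases "c < b")
          case True
          have "\<not> even (b - 1 - c)" "c \<le> b - 1" using c True by presburger+
          then have "?p' (b - 1) = p (b - 1) - 1"
            using True c by (subst zexp_move_down) auto
          also have "p (b - 1) = m" using p by (simp add: b_def)
          finally show False using m_le[OF h', of "b - 1"] by simp
        next
          case False
          then have *: "?p' x = p x + (if b \<le> x \<and> x < c then if even (x - b) then - 1 else 1 else 0)" for x
            using c by (intro zexp_move_up) auto
          have "?E ?p'" using p h' unfolding * by (auto simp: b_def)
          then have "p b \<le> ?p' b" by (rule least)
          then show False unfolding * using False c by auto
        qed
      qed
    qed (use p in simp)
    then have "p b = m" using p by (simp add: b_def)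
    then have "\<forall>x\<in>{a0..a0 + int (Suc n)}. p x = m"
      using p by (auto simp: b_def) (smt (verit) atLeastAtMost_iff)
    then show ?case using p by blast
  qed
  from this[of "nat (\<bar>W\<bar> + 1)"] obtain p where p: "h p \<noteq> 0" "\<forall>x\<in>{a0..a0 + int (nat (\<bar>W\<bar> + 1))}. p x = m"
    by blast
  then have "p a0 \<noteq> 0" "p (a0 + int (nat (\<bar>W\<bar> + 1))) \<noteq> 0" using \<open>m < 0\<close> by auto
  from W[OF p(1) this] show False by simp
qed

text \<open>Here a zero propagates to the right until it reaches the last positive entry.\<close>

lemma connected:
  assumes "h p \<noteq> 0" "l < a" "a < r" "0 < p l" "0 < p r"
  shows "0 < p a"
proof (rule ccontr)
  assume "\<not> 0 < p a"
  then have pa: "p a = 0" using nonneg[OF assms(1), of a] by simp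
  obtain W where W: "\<And>p a b. h p \<noteq> 0 \<Longrightarrow> p a \<noteq> 0 \<Longrightarrow> p b \<noteq> 0 \<Longrightarrow> b - a \<le> W"
    using bounded_width by blast
  \<comment> \<open>With \<open>l\<close> fixed, \<open>r\<close> is taken as far right as possible
    over all exponents having a gap between \<open>l\<close> and \<open>r\<close>. This stops a move
    from creating a positive entry beyond \<open>r\<close>.\<close>
  define G where "G r \<longleftrightarrow> (\<exists>p a. h p \<noteq> 0 \<and> l < a \<and> a < r \<and> 0 < p l \<and> p a = 0 \<and> 0 < p r)" for r
  have "G r" using assms pa G_def by blast
  moreover have "r \<le> l + W" if "G r" for r
    using that W[of _ l r] unfolding G_def by force
  ultimately obtain r where "G r" and greatest: "\<And>r'. G r' \<Longrightarrow> r' \<le> r"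
    using int_valued_maximizer[of G "\<lambda>r. r" "l + W"] by blast
  then obtain p a where pa: "h p \<noteq> 0" "l < a" "a < r" "0 < p l" "p a = 0" "0 < p r"
    unfolding G_def by blast
  have "\<exists>p. h p \<noteq> 0 \<and> 0 < p l \<and> p (a + int n) = 0 \<and> 0 < p r" if "a + int n \<le> r" for n
    using that
  proof (induction n)
    case 0
    then show ?case using pa by auto
  next
    case (Suc n)
    define b where "b = a + int n + 1"
    have b: "l < b - 1" "b \<le> r" using Suc pa by (auto simp: b_def)
    let ?E = "\<lambda>p. h p \<noteq> 0 \<and> 0 < p l \<and> p (b - 1) = 0 \<and> 0 < p r"
    have "\<exists>p. ?E p" using Suc by (simp add: b_def)
    then have "\<exists>p. ?E p \<and> (\<forall>p'. ?E p' \<longrightarrow> p b \<le> p' b)"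
      by (rule int_valued_minimizer[where N = 0]) (use nonneg in blast)
    then obtain p where p: "?E p" and least: "\<And>p'. ?E p' \<Longrightarrow> p b \<le> p' b"
      by blast
    have "p b = p (b - 1)"
    proof (rule single_term)
      fix c assume c: "even (c - b)" "c \<noteq> b"
      let ?p' = "p + zexp b - zexp c"
      show "h ?p' = 0"
      proof (rule ccontr)
        assume h': "h ?p' \<noteq> 0"
        show False
        \<comment> \<open>For \<open>c < b\<close> the zero at \<open>b - 1\<close> becomes -1. For
          \<open>c > b\<close> the new exponent has a gap at \<open>b - 1\<close> before the
          positive entry at \<open>c - 1\<close>, so \<open>c - 1 \<le> r\<close>; then the entry at
          \<open>r\<close> stays positive while the one at \<open>b\<close> has dropped.\<close>
        proof (cases "c < b")
          case True
          have "\<not> even (b - 1 - c)" "c \<le> b - 1" using c True by presburger+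
          then have "?p' (b - 1) = p (b - 1) - 1"
            using True c by (subst zexp_move_down) auto
          then show False using nonneg[OF h', of "b - 1"] p by simp
        next
          case False
          then have *: "?p' x = p x + (if b \<le> x \<and> x < c then if even (x - b) then - 1 else 1 else 0)" for x
            using c by (intro zexp_move_up) auto
          have 1: "?p' l = p l" "?p' (b - 1) = 0" "?p' b = p b - 1"
            using b p False c unfolding * by auto
          have odd: "odd (c - 1 - b)" "b \<le> c - 1" using c False by presburger+
          then have 2: "?p' (c - 1) = p (c - 1) + 1" unfolding * by auto
          have "c - 1 \<le> r"
          proof (rule ccontr)
            assume "\<not> c - 1 \<le> r"
            moreover have "G (c - 1)"
              unfolding G_def using h' 1 2 b p odd nonneg[of p "c - 1"]
              by (intro exI[of _ ?p'] exI[of _ "b - 1"]) auto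
            ultimately show False using greatest by fastforce
          qed
          then have "0 < ?p' r" using odd p unfolding * by (cases "c - 1 = r") auto
          then show False using least[of ?p'] 1 h' p by simp
        qed
      qed
    qed (use p in simp)
    moreover have "a + int (Suc n) = b" by (simp add: b_def)
    ultimately show ?case using p by auto
  qed
  from this[of "nat (r - a)"] show False using pa(3) by auto
qed

text \<open>Among the exponents of maximal width, the last entry can be lowered to 1, and then this value
  propagates to the left end.\<close>

lemma exists_block:
  assumes "h p \<noteq> 0"
  shows "\<exists>l r. l \<le> r \<and> h (block l r) \<noteq> 0"
proof -
  obtain W where W: "\<And>p a b. h p \<noteq> 0 \<Longrightarrow> p a \<noteq> 0 \<Longrightarrow> p b \<noteq> 0 \<Longrightarrow> b - a \<le> W"
    using bounded_width by blast
  \<comment> \<open>The greatest \<open>w\<close> is the maximal distance between positive entries.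
    An exponent positive at both ends of an interval of this length vanishes outside it.\<close>
  define G where "G w \<longleftrightarrow> (\<exists>p l. h p \<noteq> 0 \<and> 0 < p l \<and> 0 < p (l + w))" for w
  have "p \<noteq> 0" using assms zero_exponent by auto
  then obtain x where "p x \<noteq> 0" by fastforce
  then have "0 < p x" using nonneg[OF assms, of x] by simp
  then have "G 0" using assms unfolding G_def by auto
  moreover have "w \<le> W" if "G w" for w
  proof -
    obtain p l where "h p \<noteq> 0" "0 < p l" "0 < p (l + w)"
      using \<open>G w\<close> unfolding G_def by blast
    then show ?thesis using W[of p l "l + w"] by simp
  qed
  ultimately obtain w where "G w" and greatest: "\<And>w'. G w' \<Longrightarrow> w' \<le> w"
    using int_valued_maximizer[of G "\<lambda>r. r" W] by blast
  then obtain p l where pl: "h p \<noteq> 0" "0 < p l" "0 < p (l + w)" unfolding G_def by blast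
  define r where "r = l + w"
  have "l \<le> r" using greatest[OF \<open>G 0\<close>] by (simp add: r_def)
  let ?S = "\<lambda>p. h p \<noteq> 0 \<and> 0 < p l \<and> 0 < p r"
  have S: "?S p" using pl r_def by simp
  have width: "b - a \<le> w" if "h p \<noteq> 0" "0 < p a" "0 < p b" for p a b
    using that greatest[of "b - a"] unfolding G_def by force
  have outside: "p x = 0" if "?S p" "x < l \<or> r < x" for p x
  proof (rule ccontr)
    assume "p x \<noteq> 0"
    then have "0 < p x" using nonneg[of p x] that by auto
    then show False using width[of p x r] width[of p l x] that by (auto simp: r_def)
  qed
  have "\<exists>p. ?S p \<and> (\<forall>x\<in>{r - int n..r}. p x = 1)" if "l \<le> r - int n" for n
    using that
  proof (induction n)
    case 0
    have "\<exists>p. ?S p \<and> (\<forall>p'. ?S p' \<longrightarrow> p r \<le> p' r)"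
      by (rule int_valued_minimizer[where N = 0]) (use nonneg S in blast)+
    then obtain p where p: "?S p" and least: "\<And>p'. ?S p' \<Longrightarrow> p r \<le> p' r"
      by blast
    have "p r = 1"
    proof (rule ccontr)
      assume "p r \<noteq> 1"
      then have ge: "2 \<le> p r" using p by simp
      have p0: "p (r + 1) = 0" by (rule outside[OF p]) simp
      \<comment> \<open>The equation just beyond the right end would equate the last entry with 0. A
        move with \<open>c \<le> r\<close> leaves the last entry positive, since it was at least 2,
        and starts inside \<open>{l..r}\<close> by maximality of the width; so it contradicts the
        minimality of \<open>p r\<close>.\<close>
      have "p (r + 1) = p (r + 1 - 1)"
      proof (rule single_term)
        fix c assume c: "even (c - (r + 1))" "c \<noteq> r + 1"
        let ?p' = "p + zexp (r + 1) - zexp c"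
        show "h ?p' = 0"
        proof (rule ccontr)
          assume h': "h ?p' \<noteq> 0"
          show False
          proof (cases "c < r + 1")
            case True
            have *: "?p' x = p x + (if c \<le> x \<and> x < r + 1 then if even (x - c) then 1 else - 1 else 0)" for x
              using True c by (intro zexp_move_down) auto
            have "odd (r - c)" "c \<le> r" using c True by presburger+
            then have 1: "?p' r = p r - 1" unfolding * by auto
            have "0 < ?p' c" using True nonneg[of p c] p unfolding * by auto
            then have "l \<le> c" using width[OF h', of c r] 1 ge by (simp add: r_def)
            then have "0 < ?p' l" using p unfolding * by auto
            then show False using least[of ?p'] 1 h' ge by simp
          next
            case False
            then have "?p' (r + 1) = p (r + 1) - 1" using c by (subst zexp_move_up) auto
            then show False using nonneg[OF h', of "r + 1"] p0 by simp
          qed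
        qed
      qed (use p in simp)
      then show False using ge p0 by simp
    qed
    then show ?case using p by auto
  next
    case (Suc n)
    define b where "b = r - int n"
    have b: "l \<le> b - 1" "b \<le> r" using Suc.prems by (auto simp: b_def)
    let ?E = "\<lambda>p. ?S p \<and> (\<forall>x\<in>{b..r}. p x = 1)"
    have "\<exists>p. ?E p" using Suc by (simp add: b_def)
    then have "\<exists>p. ?E p \<and> (\<forall>p'. ?E p' \<longrightarrow> p (b - 1) \<le> p' (b - 1))"
      by (rule int_valued_minimizer[where N = 0]) (use nonneg in blast)
    then obtain p where p: "?E p" and least: "\<And>p'. ?E p' \<Longrightarrow> p (b - 1) \<le> p' (b - 1)"
      by blast
    \<comment> \<open>A move with \<open>c < b\<close> lowers the minimal entry at
      \<open>b - 1\<close>. One with \<open>c > b\<close> makes the entry at \<open>b\<close> zero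
      between the positive entries at \<open>l\<close> and \<open>c - 1\<close>, against
      \<open>connected\<close>.\<close>
    have "p b = p (b - 1)"
    proof (rule single_term)
      fix c assume c: "even (c - b)" "c \<noteq> b"
      let ?p' = "p + zexp b - zexp c"
      show "h ?p' = 0"
      proof (rule ccontr)
        assume h': "h ?p' \<noteq> 0"
        show False
        proof (cases "c < b")
          case True
          have *: "?p' x = p x + (if c \<le> x \<and> x < b then if even (x - c) then 1 else - 1 else 0)" for x
            using True c by (intro zexp_move_down) auto
          have "odd (b - 1 - c)" "c \<le> b - 1" using c True by presburger+
          then have 1: "?p' (b - 1) = p (b - 1) - 1" unfolding * by auto
          have 2: "?p' x = p x" if "b \<le> x" for x using that unfolding * by auto
          have "0 < ?p' c" using True nonneg[of p c] p unfolding * by auto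
          then have "l \<le> c" using width[OF h', of c r] 2[of r] p b by (simp add: r_def)
          then have "0 < ?p' l" using p unfolding * by auto
          then show False using least[of ?p'] 1 2 h' p b by simp
        next
          case False
          then have *: "?p' x = p x + (if b \<le> x \<and> x < c then if even (x - b) then - 1 else 1 else 0)" for x
            using c by (intro zexp_move_up) auto
          have odd: "odd (c - 1 - b)" "b < c - 1" using c False by presburger+
          have "0 < ?p' l" using p b unfolding * by auto
          moreover have "0 < ?p' (c - 1)" using odd nonneg[of p "c - 1"] p unfolding * by auto
          moreover have "?p' b = 0" using p b False c unfolding * by auto
          ultimately show False using connected[OF h', of l b "c - 1"] odd b by auto
        qed
      qed
    qed (use p in simp)
    then have "p (b - 1) = 1" using p b by simp
    then have "\<forall>x\<in>{r - int (Suc n)..r}. p x = 1"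
      using p by (auto simp: b_def) (smt (verit) atLeastAtMost_iff)
    then show ?case using p by blast
  qed
  from this[of "nat (r - l)"] obtain p where p: "?S p" "\<forall>x\<in>{l..r}. p x = 1"
    using \<open>l \<le> r\<close> by auto
  have "p = block l r"
    using p outside[OF p(1)] by (auto simp: block_def fun_eq_iff)
  then show ?thesis using p \<open>l \<le> r\<close> by blast
qed

text \<open>The two blocks differ by 1 at one end and -1 at the other. This is an alternating string
  only for blocks with a single entry, where one equation suffices; longer blocks need a chain of
  equations through intermediate exponents.\<close>

lemma block_pred:
  assumes "l \<le> r"
  shows "h (block (l - 1) (r - 1)) = h (block l r)"
proof (cases "l = r")
  case True
  have fin: "finite {a. block l l a \<noteq> 0}"
    by (rule finite_subset[of _ "{l}"]) (auto simp: block_def)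
  have eq: "block l l + zexp (l + 1) - zexp (l - 1) = block (l - 1) (l - 1)"
    by (auto simp: fun_eq_iff zexp_def block_def; presburger)
  have "h (block l l) * gam (l + 1) (block l l) =
    - (h (block l l + zexp (l + 1) - zexp (l - 1)) * gam (l - 1) (block l l + zexp (l + 1) - zexp (l - 1)))"
  proof (rule two_terms[OF fin])
    fix d assume d: "even (d - (l + 1))" "d \<noteq> l + 1" "d \<noteq> l - 1"
    let ?p' = "block l l + zexp (l + 1) - zexp d"
    have "d < l - 1 \<or> l + 1 < d" using d by presburger
    then consider "d < l - 1" | "l + 1 < d" by blast
    then show "h ?p' = 0"
    proof cases
      case 1
      then have "d + 1 < l" using d by presburger
      then have "?p' (d + 1) = - 1"
        using d by (subst zexp_move_down) (auto simp: block_def)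
      then show ?thesis using nonneg[of ?p' "d + 1"] by force
    next
      case 2
      then have "?p' (l + 1) = - 1"
        using d by (subst zexp_move_up) (auto simp: block_def)
      then show ?thesis using nonneg[of ?p' "l + 1"] by force
    qed
  qed auto
  then have "(h (block l l) - h (block (l - 1) (l - 1))) * (1 - qpow (- 1)) = 0"
    unfolding eq by (simp add: gam_def block_def algebra_simps)
  then have "h (block l l) = h (block (l - 1) (l - 1))" by simp
  then show ?thesis using True by simp
next
  case False
  define s where "s = r - 1"
  have "l \<le> s" using assms False by (simp add: s_def)
  \<comment> \<open>The two blocks of width \<open>s - l + 2\<close> are linked by the chain of the exponents \<open>u l, \<dots>, u s\<close>.\<close>
  define u where "u j = block l s + block j j" for j
  \<comment> \<open>For \<open>l \<le> j \<le> s\<close> these are \<open>gam j (u j)\<close> and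
    \<open>- gam (j + 1) (u j)\<close>: the factors of \<open>h (u j)\<close> in its equations with
    the next and with the previous member of the chain.\<close>
  define \<alpha> where "\<alpha> j = qpow (- 2) - (if l < j then qpow (- 1) else 1)" for j
  define \<beta> where "\<beta> j = qpow (- 2) - (if j < s then qpow (- 1) else 1)" for j
  have fin: "finite {a. u j a \<noteq> 0}" for j
    by (rule finite_subset[of _ "{l..s} \<union> {j}"]) (auto simp: u_def block_def split: if_splits)
  have u: "u j x = (if l \<le> x \<and> x \<le> s then 1 else 0) + (if x = j then 1 else 0)" for j x
    by (auto simp: u_def block_def)
  have left: "\<beta> l * h (u l) = (qpow (- 1) - 1) * h (block (l - 1) s)"
  proof -
    have eq: "u l + zexp (l + 1) - zexp (l - 1) = block (l - 1) s"
      using \<open>l \<le> s\<close> by (auto simp: fun_eq_iff zexp_def block_def u; presburger)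
    have "h (u l) * gam (l + 1) (u l) =
      - (h (u l + zexp (l + 1) - zexp (l - 1)) * gam (l - 1) (u l + zexp (l + 1) - zexp (l - 1)))"
    proof (rule two_terms[OF fin])
      fix d assume d: "even (d - (l + 1))" "d \<noteq> l + 1" "d \<noteq> l - 1"
      let ?p' = "u l + zexp (l + 1) - zexp d"
      \<comment> \<open>All remaining moves produce a negative entry, or an entry that is not
        positive between two positive ones. The same dichotomy serves the other links of the
        chain.\<close>
      have "d < l - 1 \<or> l + 1 < d" using d by presburger
      then consider "d < l - 1" | "l + 1 < d" by blast
      then show "h ?p' = 0"
      proof cases
        case 1
        then have "d + 1 < l" using d by presburger
        then have "?p' (d + 1) = - 1"
          using d by (subst zexp_move_down) (auto simp: u)
        then show ?thesis using nonneg[of ?p' "d + 1"] by force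
      next
        case 2
        then have *: "?p' x = u l x + (if l + 1 \<le> x \<and> x < d then if even (x - (l + 1)) then - 1 else 1 else 0)" for x
          using d by (intro zexp_move_up) auto
        have d': "l + 1 < d - 1" "odd (d - 1 - (l + 1))" using 2 d by presburger+
        then have "?p' (l + 1) \<le> 0" "0 < ?p' l" "0 < ?p' (d - 1)" unfolding * u using \<open>l \<le> s\<close> by auto
        then show ?thesis using connected[of ?p' l "l + 1" "d - 1"] d' by force
      qed
    qed auto
    then show ?thesis
      using \<open>l \<le> s\<close> unfolding eq by (cases "l = s") (auto simp: gam_def u \<beta>_def block_def algebra_simps)
  qed
  have right: "\<alpha> s * h (u s) = (qpow (- 1) - 1) * h (block l (s + 1))"
  proof -
    have eq: "u s + zexp s - zexp (s + 2) = block l (s + 1)"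
      using \<open>l \<le> s\<close> by (auto simp: fun_eq_iff zexp_def block_def u; presburger)
    have "h (u s) * gam s (u s) =
      - (h (u s + zexp s - zexp (s + 2)) * gam (s + 2) (u s + zexp s - zexp (s + 2)))"
    proof (rule two_terms[OF fin])
      fix d assume d: "even (d - s)" "d \<noteq> s" "d \<noteq> s + 2"
      let ?p' = "u s + zexp s - zexp d"
      have "d < s \<or> s + 2 < d" using d by presburger
      then consider "d < s" | "s + 2 < d" by blast
      then show "h ?p' = 0"
      proof cases
        case 1
        then have *: "?p' x = u s x + (if d \<le> x \<and> x < s then if even (x - d) then 1 else - 1 else 0)" for x
          using d by (intro zexp_move_down) auto
        have d': "d < s - 1" "odd (s - 1 - d)" using 1 d by presburger+
        then have "?p' (s - 1) \<le> 0" "0 < ?p' d" "0 < ?p' s" unfolding * u using \<open>l \<le> s\<close> by auto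
        then show ?thesis using connected[of ?p' d "s - 1" s] d' by force
      next
        case 2
        then have "?p' (s + 2) = - 1"
          using d by (subst zexp_move_up) (auto simp: u)
        then show ?thesis using nonneg[of ?p' "s + 2"] by force
      qed
    qed auto
    then show ?thesis
      using \<open>l \<le> s\<close> unfolding eq by (cases "l = s") (auto simp: gam_def u \<alpha>_def block_def algebra_simps)
  qed
  have step: "\<beta> (j + 1) * h (u (j + 1)) = \<alpha> j * h (u j)" if j: "l \<le> j" "j < s" for j
  proof -
    have eq: "u j + zexp j - zexp (j + 2) = u (j + 1)"
      using j by (auto simp: fun_eq_iff zexp_def u; presburger)
    have "h (u j) * gam j (u j) =
      - (h (u j + zexp j - zexp (j + 2)) * gam (j + 2) (u j + zexp j - zexp (j + 2)))"
    proof (rule two_terms[OF fin])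
      fix d assume d: "even (d - j)" "d \<noteq> j" "d \<noteq> j + 2"
      let ?p' = "u j + zexp j - zexp d"
      have "d < j \<or> j + 2 < d" using d by presburger
      then consider "d < j" | "j + 2 < d" by blast
      then show "h ?p' = 0"
      proof cases
        case 1
        then have *: "?p' x = u j x + (if d \<le> x \<and> x < j then if even (x - d) then 1 else - 1 else 0)" for x
          using d by (intro zexp_move_down) auto
        have d': "d < j - 1" "odd (j - 1 - d)" using 1 d by presburger+
        then have "?p' (j - 1) \<le> 0" "0 < ?p' d" "0 < ?p' j" unfolding * u using j by auto
        then show ?thesis using connected[of ?p' d "j - 1" j] d' by force
      next
        case 2
        then have *: "?p' x = u j x + (if j \<le> x \<and> x < d then if even (x - j) then - 1 else 1 else 0)" for x
          using d by (intro zexp_move_up) auto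
        have d': "j + 2 < d - 1" "odd (d - 1 - j)" using 2 d by presburger+
        then have "?p' (j + 2) \<le> 0" "0 < ?p' j" "0 < ?p' (d - 1)" unfolding * u using j by auto
        then show ?thesis using connected[of ?p' j "j + 2" "d - 1"] d' by force
      qed
    qed auto
    then show ?thesis
      using j unfolding eq by (auto simp: gam_def u \<alpha>_def \<beta>_def algebra_simps split: if_splits)
  qed
  \<comment> \<open>The interior factors cancel because \<open>\<alpha> j = \<beta> j\<close> for
    \<open>l < j < s\<close>; the two that remain, \<open>\<alpha> l\<close> and
    \<open>\<beta> s\<close>, are equal.\<close>
  have "h (u l) = h (u s)"
  proof (cases "l = s")
    case False
    have "l + 1 + int n \<le> s \<Longrightarrow> \<beta> (l + 1 + int n) * h (u (l + 1 + int n)) = \<alpha> l * h (u l)" for n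
    proof (induction n)
      case 0
      then show ?case using step[of l] by simp
    next
      case (Suc n)
      have "\<alpha> (l + 1 + int n) = \<beta> (l + 1 + int n)"
        using Suc.prems by (simp add: \<alpha>_def \<beta>_def)
      then show ?case using step[of "l + 1 + int n"] Suc by (simp add: add.assoc add.commute)
    qed
    from this[of "nat (s - l - 1)"] have "\<beta> s * h (u s) = \<alpha> l * h (u l)"
      using False \<open>l \<le> s\<close> by simp
    then show ?thesis by (simp add: \<alpha>_def \<beta>_def)
  qed simp
  moreover have "\<beta> l = \<alpha> s" by (auto simp: \<alpha>_def \<beta>_def)
  ultimately have "(qpow (- 1) - 1) * h (block (l - 1) s) = (qpow (- 1) - 1) * h (block l (s + 1))"
    using left right by simp
  then show ?thesis by (auto simp: s_def)
qed

lemma block_translate: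
  assumes "l \<le> r"
  shows "h (block (l + c) (r + c)) = h (block l r)"
proof -
  have down: "h (block (l - int n) (r - int n)) = h (block l r)" if "l \<le> r" for n l r
  proof (induction n)
    case (Suc n)
    then show ?case using block_pred[of "l - int n" "r - int n"] that
      by (simp add: algebra_simps)
  qed simp
  show ?thesis
  proof (cases "0 \<le> c")
    case True
    then show ?thesis using down[of "l + c" "r + c" "nat c"] assms by simp
  next
    case False
    then show ?thesis using down[of l r "nat (- c)"] assms by simp
  qed
qed

end

section \<open>Exponents of words\<close>

fun gpos :: "gen \<Rightarrow> int" where
  "gpos (X k) = 2 * k"
| "gpos (Xi k) = 2 * k"
| "gpos (Y k) = 2 * k + 1"
| "gpos (Yi k) = 2 * k + 1"

fun gsgn :: "gen \<Rightarrow> int" where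
  "gsgn (X k) = 1"
| "gsgn (Xi k) = - 1"
| "gsgn (Y k) = 1"
| "gsgn (Yi k) = - 1"

definition wpair :: "(int \<Rightarrow> int) \<Rightarrow> word \<Rightarrow> int" where
  "wpair f w = (\<Sum>g\<leftarrow>letters w. gsgn g * f (gpos g))"

text \<open>This encoding makes commutation exponents linear: for \<open>b < a\<close>,
  \<open>z_b z_a\<close> equals \<open>z_a z_b\<close> times the power \<open>zexp b (a - 1)\<close>
  of \<open>q\<close>, and \<open>zexp b (a - 1)\<close> is 0 for \<open>b \<ge> a\<close>. So
  \<open>wexp w (a - 1)\<close> gathers the exponents of \<open>z_a\<close> against all letters of
  \<open>w\<close> at smaller positions.\<close>

definition wexp :: "word \<Rightarrow> int \<Rightarrow> int" where
  "wexp w x = wpair (\<lambda>b. zexp b x) w"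

text \<open>\<open>kap w\<close> is the power of \<open>q\<close> produced by ordering the letters of \<open>w\<close> by position.\<close>

fun lkap :: "gen list \<Rightarrow> int" where
  "lkap [] = 0"
| "lkap (g # u) = lkap u - gsgn g * wexp (Word u) (gpos g - 1)"

definition kap :: "word \<Rightarrow> int" where
  "kap w = lkap (letters w)"

lemma wpair_plus [simp]: "wpair f (u + v) = wpair f u + wpair f v"
  by (simp add: wpair_def plus_word_def)

lemma wpair_zero [simp]: "wpair f 0 = 0"
  by (simp add: wpair_def zero_word_def)

lemma wpair_Word: "wpair f (Word []) = 0" "wpair f (Word (g # u)) = gsgn g * f (gpos g) + wpair f (Word u)"
  by (simp_all add: wpair_def)

lemma wpair_fun_add: "wpair (\<lambda>a. f a + f' a) w = wpair f w + wpair f' w"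
  unfolding wpair_def by (induction "letters w" arbitrary: w) (auto simp: algebra_simps sum_list_addf)

lemma wexp_plus [simp]: "wexp (u + v) = wexp u + wexp v"
  by (simp add: wexp_def fun_eq_iff)

lemma wexp_zero [simp]: "wexp 0 = 0"
  by (simp add: wexp_def fun_eq_iff)

lemma wexp_Word: "wexp (Word []) x = 0" "wexp (Word (g # u)) x = gsgn g * zexp (gpos g) x + wexp (Word u) x"
  by (simp_all add: wexp_def wpair_Word)

lemma kap_letter [simp]: "kap (Word [g]) = 0"
  by (simp add: kap_def wexp_Word)

text \<open>Order both words first; the correction is the cost of moving each letter of
  \<open>u\<close> past the letters of \<open>v\<close> at smaller positions.\<close>

lemma kap_plus: "kap (u + v) = kap u + kap v - wpair (\<lambda>a. wexp v (a - 1)) u"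
proof -
  have "lkap (xs @ letters v) = lkap xs + kap v - wpair (\<lambda>a. wexp v (a - 1)) (Word xs)" for xs
  proof (induction xs)
    case Nil
    then show ?case by (simp add: kap_def wpair_Word)
  next
    case (Cons g xs)
    have "wexp (Word (xs @ letters v)) = wexp (Word xs) + wexp v"
      using wexp_plus[of "Word xs" v] by (simp add: plus_word_def)
    then show ?case using Cons by (simp add: wpair_Word algebra_simps)
  qed
  from this[of "letters u"] show ?thesis by (simp add: kap_def plus_word_def)
qed

lemma word_deg_plus [simp]: "word_deg (u + v) = word_deg u + word_deg v"
  by (simp add: word_deg_def plus_word_def)

lemma word_deg_Word: "word_deg (Word []) = 0" "word_deg (Word (g # u)) = gen_deg g + word_deg (Word u)"
  by (simp_all add: word_deg_def)

lemma gen_deg_sgn: "gen_deg g = gsgn g * (if even (gpos g) then 1 else - 1)"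
  by (cases g) auto

text \<open>Either \<open>b < a\<close> or \<open>a \<le> b\<close>, so one of the two entries is
  zero. The parity factor is the product of the degrees of \<open>z_a\<close> and
  \<open>z_b\<close>; it sums to the product of word degrees in \<open>wpair_swap\<close> and
  disappears in degree 0.\<close>

lemma zexp_swap: "zexp b (a - 1) = zexp a b + (if even a then 1 else - 1) * (if even b then 1 else - 1)"
proof (cases "b < a")
  case True
  then show ?thesis by (auto simp: zexp_def)
next
  case False
  then show ?thesis by (auto simp: zexp_def)
qed

lemma wpair_swap: "wpair (\<lambda>a. wexp v (a - 1)) u = wpair (wexp u) v + word_deg u * word_deg v"
proof -
  have 1: "wexp (Word ys) (gpos g - 1) * gsgn g =
      wpair (\<lambda>b. gsgn g * zexp (gpos g) b) (Word ys) + gen_deg g * word_deg (Word ys)" for g ys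
  proof (induction ys)
    case (Cons g' ys)
    have "gsgn g' * zexp (gpos g') (gpos g - 1) * gsgn g =
       gsgn g' * (gsgn g * zexp (gpos g) (gpos g')) + gen_deg g * gen_deg g'"
      unfolding gen_deg_sgn zexp_swap by (simp add: algebra_simps)
    then show ?case using Cons by (simp add: wexp_Word wpair_Word word_deg_Word algebra_simps)
  qed (simp add: wexp_Word wpair_Word word_deg_Word)
  have "wpair (\<lambda>a. wexp (Word ys) (a - 1)) (Word xs) =
      wpair (wexp (Word xs)) (Word ys) + word_deg (Word xs) * word_deg (Word ys)" for xs ys
  proof (induction xs)
    case Nil
    have "wexp (Word []) = (\<lambda>b. 0)" by (simp add: fun_eq_iff wexp_Word)
    then show ?case by (simp add: wpair_Word word_deg_Word wpair_def)
  next
    case (Cons g xs)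
    have "wexp (Word (g # xs)) = (\<lambda>b. gsgn g * zexp (gpos g) b + wexp (Word xs) b)"
      by (simp add: fun_eq_iff wexp_Word)
    then show ?case using Cons 1[of ys g]
      by (simp add: wpair_Word word_deg_Word wpair_fun_add algebra_simps)
  qed
  from this[of "letters v" "letters u"] show ?thesis by simp
qed

lemma wexp_deg:
  assumes "\<And>g. g \<in> set (letters w) \<Longrightarrow> gpos g \<le> x"
  shows "wexp w x = (if even x then - 1 else 1) * word_deg w"
proof -
  have "(\<forall>g\<in>set xs. gpos g \<le> x) \<longrightarrow> wexp (Word xs) x = (if even x then - 1 else 1) * word_deg (Word xs)" for xs
    by (induction xs) (auto simp: wexp_Word word_deg_Word gen_deg_sgn zexp_def algebra_simps)
  from this[of "letters w"] show ?thesis using assms by simp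
qed

lemma wexp_left:
  assumes "\<And>g. g \<in> set (letters w) \<Longrightarrow> x < gpos g"
  shows "wexp w x = 0"
proof -
  have "(\<forall>g\<in>set xs. x < gpos g) \<longrightarrow> wexp (Word xs) x = 0" for xs
    by (induction xs) (auto simp: wexp_Word zexp_def)
  from this[of "letters w"] show ?thesis using assms by simp
qed

lemma letters_bounded: "\<exists>A B. \<forall>g\<in>set (letters w). A < gpos g \<and> gpos g \<le> B"
proof -
  have "finite (gpos ` set (letters w))" by simp
  then obtain A B where "\<forall>x\<in>gpos ` set (letters w). A \<le> x" "\<forall>x\<in>gpos ` set (letters w). x \<le> B"
    by (metis bdd_above_finite bdd_below_finite bdd_above_def bdd_below_def)
  then show ?thesis by (intro exI[of _ "A - 1"] exI[of _ B]) auto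
qed

text \<open>To the right of all letters the entries alternate between plus and minus the
  degree.\<close>

lemma finite_wexp_iff: "finite {a. wexp w a \<noteq> 0} \<longleftrightarrow> word_deg w = 0"
proof -
  obtain A B where AB: "\<forall>g\<in>set (letters w). A < gpos g \<and> gpos g \<le> B"
    using letters_bounded by blast
  show ?thesis
  proof
    assume fin: "finite {a. wexp w a \<noteq> 0}"
    show "word_deg w = 0"
    proof (rule ccontr)
      assume "word_deg w \<noteq> 0"
      moreover have "wexp w a = (if even a then - 1 else 1) * word_deg w" if "B \<le> a" for a
        by (rule wexp_deg) (use AB that in force)
      ultimately have "{B..} \<subseteq> {a. wexp w a \<noteq> 0}"
        by (auto split: if_splits)
      then have "finite {B..}" using fin by (rule finite_subset)
      then show False using infinite_Ici by blast
    qed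
  next
    assume deg: "word_deg w = 0"
    have "{a. wexp w a \<noteq> 0} \<subseteq> {A..B}"
    proof
      fix a assume a: "a \<in> {a. wexp w a \<noteq> 0}"
      have "A \<le> a" using a wexp_left[of w a] AB by (meson dual_order.strict_trans linorder_not_le mem_Collect_eq)
      moreover have "a \<le> B"
      proof (rule ccontr)
        assume "\<not> a \<le> B"
        then have "wexp w a = 0" using AB deg by (subst wexp_deg) force+
        then show False using a by simp
      qed
      ultimately show "a \<in> {A..B}" by simp
    qed
    then show "finite {a. wexp w a \<noteq> 0}" by (rule finite_subset) simp
  qed
qed

text \<open>The action of the \<open>i\<close>-th power of the shift on exponents.\<close>

definition texp :: "int \<Rightarrow> (int \<Rightarrow> int) \<Rightarrow> int \<Rightarrow> int" where
  "texp i p x = p (x - 2 * i)"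

lemma texp_texp [simp]: "texp i (texp j p) = texp (i + j) p"
  by (simp add: texp_def fun_eq_iff algebra_simps)

lemma texp_0 [simp]: "texp 0 p = p"
  by (simp add: texp_def fun_eq_iff)

lemma texp_zero [simp]: "texp i 0 = 0"
  by (simp add: texp_def fun_eq_iff)

lemma texp_diff: "texp i (p - r) = texp i p - texp i r"
  by (simp add: texp_def fun_eq_iff)

lemma texp_zexp: "texp i (zexp b) = zexp (b + 2 * i)"
proof -
  have "x - 2 * i < b \<longleftrightarrow> x < b + 2 * i" "even (x - 2 * i - b) \<longleftrightarrow> even (x - (b + 2 * i))" for x
    by presburger+
  then show ?thesis by (simp add: texp_def zexp_def fun_eq_iff)
qed

lemma gpos_shift: "gpos (shift_gen i g) = gpos g + 2 * i" "gsgn (shift_gen i g) = gsgn g"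
  by (cases g; simp)+

lemma wpair_shift: "wpair f (shift_word i w) = wpair (\<lambda>a. f (a + 2 * i)) w"
  by (simp add: wpair_def shift_word_def gpos_shift comp_def)

lemma wexp_shift: "wexp (shift_word i w) = texp i (wexp w)"
proof
  fix x
  have "wexp (shift_word i w) x = wpair (\<lambda>b. texp i (zexp b) x) w"
    unfolding wexp_def wpair_shift texp_zexp ..
  then show "wexp (shift_word i w) x = texp i (wexp w) x"
    by (simp add: texp_def wexp_def)
qed

lemma kap_shift: "kap (shift_word i w) = kap w"
proof -
  have "lkap (map (shift_gen i) xs) = lkap xs" for xs
  proof (induction xs)
    case (Cons g xs)
    have "wexp (Word (map (shift_gen i) xs)) (gpos (shift_gen i g) - 1) = wexp (Word xs) (gpos g - 1)"
      using wexp_shift[of i "Word xs"] by (simp add: shift_word_def texp_def gpos_shift)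
    then show ?case using Cons by (simp add: gpos_shift)
  qed simp
  then show ?thesis by (simp add: kap_def shift_word_def)
qed

lemma word_deg_shift: "word_deg (shift_word i w) = word_deg w"
proof -
  have "gen_deg (shift_gen i g) = gen_deg g" for g by (cases g) auto
  then show ?thesis by (simp add: word_deg_def shift_word_def comp_def)
qed

section \<open>Coefficients in the monomial basis\<close>

type_synonym coeffs = "(int \<Rightarrow> int) \<Rightarrow>\<^sub>0 laurent"

text \<open>A word goes to its ordered monomial with the power of \<open>q\<close> given by
  \<open>kap\<close>. Once this respects the relations, it yields coordinate functions on
  \<open>A_q\<close> and hence the linear independence of the monomials.\<close>

definition falg_coeffs :: "falg \<Rightarrow> coeffs" where
  "falg_coeffs a = (\<Sum>w\<in>Poly_Mapping.keys a.
     Poly_Mapping.single (wexp w) (qpow (kap w) * Poly_Mapping.lookup a w))"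

lemma falg_coeffs_superset:
  assumes "finite S" "Poly_Mapping.keys a \<subseteq> S"
  shows "falg_coeffs a = (\<Sum>w\<in>S. Poly_Mapping.single (wexp w) (qpow (kap w) * Poly_Mapping.lookup a w))"
  unfolding falg_coeffs_def using assms
  by (intro sum.mono_neutral_left) (auto simp: in_keys_iff)

lemma falg_coeffs_single:
  "falg_coeffs (Poly_Mapping.single w c) = Poly_Mapping.single (wexp w) (qpow (kap w) * c)"
  by (simp add: falg_coeffs_def)

lemma falg_coeffs_zero [simp]: "falg_coeffs 0 = 0"
  by (simp add: falg_coeffs_def)

lemma falg_coeffs_add: "falg_coeffs (a + b) = falg_coeffs a + falg_coeffs b"
proof -
  let ?S = "Poly_Mapping.keys a \<union> Poly_Mapping.keys b"
  have "falg_coeffs (a + b) = (\<Sum>w\<in>?S. Poly_Mapping.single (wexp w) (qpow (kap w) * Poly_Mapping.lookup (a + b) w))"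
    using Poly_Mapping.keys_add[of a b] by (intro falg_coeffs_superset) auto
  also have "\<dots> = falg_coeffs a + falg_coeffs b"
    by (simp add: falg_coeffs_superset[where S = ?S] lookup_add distrib_left single_add sum.distrib)
  finally show ?thesis .
qed

lemma falg_coeffs_diff: "falg_coeffs (a - b) = falg_coeffs a - falg_coeffs b"
  using falg_coeffs_add[of "a - b" b] by simp

text \<open>Inside a larger word, \<open>w\<close> influences the ordering exponent only through its
  own \<open>kap\<close>, its exponent and its pairings, so equality of these data survives any
  context.\<close>

lemma falg_coeffs_context:
  assumes "wexp w = wexp w'" "\<And>f. wpair f w = wpair f w'" "qpow (kap w) * c = qpow (kap w') * c'"
  shows "falg_coeffs (a * Poly_Mapping.single w c * b) = falg_coeffs (a * Poly_Mapping.single w' c' * b)"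
proof -
  have 1: "falg_coeffs (Poly_Mapping.single u r * Poly_Mapping.single w c * Poly_Mapping.single v s) =
      falg_coeffs (Poly_Mapping.single u r * Poly_Mapping.single w' c' * Poly_Mapping.single v s)" for u v r s
  proof -
    define k where "k = kap u + kap v - wpair (\<lambda>a. (wexp w + wexp v) (a - 1)) u - wpair (\<lambda>a. wexp v (a - 1)) w"
    have "kap (u + w + v) = kap w + k" "kap (u + w' + v) = kap w' + k"
      using assms(1,2) by (simp_all add: kap_plus k_def wpair_fun_add add.assoc)
    then have *: "qpow (kap (u + w + v)) * (r * c * s) = qpow (kap (u + w' + v)) * (r * c' * s)"
      using assms(3) by (simp add: qpow_add ac_simps)
    show ?thesis
      by (simp only: mult_single falg_coeffs_single wexp_plus assms(1) *)
  qed
  have 2: "falg_coeffs (Poly_Mapping.single u r * Poly_Mapping.single w c * b) =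
      falg_coeffs (Poly_Mapping.single u r * Poly_Mapping.single w' c' * b)" for u r
    by (induction b rule: poly_mapping_single_induct) (simp_all add: 1 distrib_left falg_coeffs_add)
  show ?thesis
    by (induction a rule: poly_mapping_single_induct) (simp_all add: 2 distrib_right falg_coeffs_add)
qed

lemma falg_coeffs_rel:
  assumes "aq_rel a b"
  shows "falg_coeffs (u * a * v) = falg_coeffs (u * b * v)"
proof -
  \<comment> \<open>Each relation equates two multiples of single words with equal exponents; this
    puts the unit on the right of the inverse relations into the same form.\<close>
  have one: "(1::falg) = Poly_Mapping.single 0 1" by simp
  have d: "even (2 * l - 1 - 2 * k) \<longleftrightarrow> False" "even (2 * l + 1 - 2 * k) \<longleftrightarrow> False"
    "even (2 * l - 2 * k) \<longleftrightarrow> True" for k l :: int by presburger+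
  show ?thesis using assms
    by cases
      (simp_all only: letter_def scalar_def mult_single one, rule_tac [!] falg_coeffs_context,
        auto simp: fun_eq_iff plus_word_def zero_word_def wexp_def wpair_Word kap_def zexp_def qvar_qpow d
          simp flip: qpow_add)
qed

lemma falg_coeffs_ideal: "a \<in> aq_ideal \<Longrightarrow> falg_coeffs a = 0"
  by (induction rule: aq_ideal.induct)
     (simp_all add: falg_coeffs_add falg_coeffs_diff falg_coeffs_rel right_diff_distrib left_diff_distrib)

lift_definition coeffs :: "aq \<Rightarrow> coeffs" is falg_coeffs
  unfolding aq_eq_def using falg_coeffs_ideal falg_coeffs_diff by (metis eq_iff_diff_eq_0)

lemma coeffs_add: "coeffs (a + b) = coeffs a + coeffs b"
  by transfer (rule falg_coeffs_add)

lemma coeffs_diff: "coeffs (a - b) = coeffs a - coeffs b"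
  by transfer (rule falg_coeffs_diff)

lemma coeffs_zero [simp]: "coeffs 0 = 0"
  by transfer simp

lemma coeffs_word: "coeffs (word_aq w) = Poly_Mapping.single (wexp w) (qpow (kap w))"
  by transfer (simp add: falg_coeffs_single)

lemma lookup_coeffs_smult:
  "Poly_Mapping.lookup (coeffs (c *\<^sub>q a)) p = c * Poly_Mapping.lookup (coeffs a) p"
proof (transfer fixing: c p)
  fix a
  show "Poly_Mapping.lookup (falg_coeffs (scalar c * a)) p = c * Poly_Mapping.lookup (falg_coeffs a) p"
    by (induction a rule: poly_mapping_single_induct)
       (simp_all add: distrib_left falg_coeffs_add lookup_add scalar_def mult_single
         falg_coeffs_single lookup_single when_def)
qed

lemma coeffs_smult_word: "coeffs (c *\<^sub>q word_aq w) = Poly_Mapping.single (wexp w) (c * qpow (kap w))"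
  by (rule poly_mapping_eqI) (simp add: lookup_coeffs_smult coeffs_word lookup_single when_def)

lemma aq_word_induct [case_names zero word add]:
  assumes "P 0" "\<And>c w. P (c *\<^sub>q word_aq w)" "\<And>a b. P a \<Longrightarrow> P b \<Longrightarrow> P (a + b)"
  shows "P a"
proof (induction a rule: aq.abs_induct)
  case (1 y)
  show ?case
  proof (induction y rule: poly_mapping_single_induct)
    case 1
    then show ?case using assms(1) by (simp add: zero_aq_def)
  next
    case (2 w c)
    have "abs_aq (Poly_Mapping.single w c) = c *\<^sub>q word_aq w"
      by (simp add: smult_aq.abs_eq word_aq_def scalar_def mult_single)
    then show ?case using assms(2) by simp
  next
    case (3 a b)
    then show ?case using assms(3) by (simp flip: plus_aq.abs_eq)
  qed
qed

lemma lookup_coeffs_shift: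
  "Poly_Mapping.lookup (coeffs (shift i a)) p = Poly_Mapping.lookup (coeffs a) (texp (- i) p)"
proof (induction a rule: aq_word_induct)
  case zero
  then show ?case using shift_diff[of i 0 0] by simp
next
  case (word c w)
  have "texp i (wexp w) = p \<longleftrightarrow> wexp w = texp (- i) p" by auto
  then show ?case
    by (simp add: shift_smult shift_word_aq coeffs_smult_word wexp_shift kap_shift lookup_single when_def)
next
  case (add a b)
  then show ?case by (simp add: shift_add coeffs_add lookup_add)
qed

lemma word_aq_plus: "word_aq (u + v) = word_aq u * word_aq v"
  by transfer (simp add: mult_single aq_eq_def aq_ideal.zero)

lemma word_aq_zero [simp]: "word_aq 0 = 1"
  by transfer (simp add: aq_eq_def aq_ideal.zero)

lemma word_aq_Nil [simp]: "word_aq (Word []) = 1"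
  using word_aq_zero by (simp add: zero_word_def)

section \<open>Reordering words up to powers of \<open>q\<close>, and the monomial basis\<close>

definition qcomm :: "aq \<Rightarrow> aq \<Rightarrow> bool" where
  "qcomm a b \<longleftrightarrow> (\<exists>k. a * b = qpow k *\<^sub>q (b * a))"

lemma qcomm_sym: "qcomm a b \<Longrightarrow> qcomm b a"
proof -
  assume "qcomm a b"
  then obtain k where "a * b = qpow k *\<^sub>q (b * a)" unfolding qcomm_def by blast
  then have "b * a = qpow (- k) *\<^sub>q (a * b)" by (simp flip: qpow_add)
  then show ?thesis unfolding qcomm_def by blast
qed

lemma qcomm_mult: "qcomm a b \<Longrightarrow> qcomm a c \<Longrightarrow> qcomm a (b * c)"
proof -
  assume "qcomm a b" "qcomm a c"
  then obtain j k where k: "a * b = qpow j *\<^sub>q (b * a)" "a * c = qpow k *\<^sub>q (c * a)"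
    unfolding qcomm_def by blast
  have "a * (b * c) = qpow (j + k) *\<^sub>q (b * c * a)"
    by (metis k mult.assoc smult_aq_mult aq.scale_scale qpow_add)
  then show ?thesis unfolding qcomm_def by blast
qed

lemma qcomm_inverse:
  assumes "qcomm a b" "a * a' = 1" "a' * a = 1"
  shows "qcomm a' b"
proof -
  obtain k where k: "b * a = qpow k *\<^sub>q (a * b)" using qcomm_sym[OF assms(1)] unfolding qcomm_def by blast
  have "a' * b = a' * (b * a) * a'" using assms(2) by (simp add: mult.assoc)
  also have "\<dots> = qpow k *\<^sub>q (b * a')"
    unfolding k smult_aq_mult by (simp add: assms(3) flip: mult.assoc)
  finally show ?thesis unfolding qcomm_def by blast
qed

fun ginv :: "gen \<Rightarrow> gen" where
  "ginv (X k) = Xi k"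
| "ginv (Xi k) = X k"
| "ginv (Y k) = Yi k"
| "ginv (Yi k) = Y k"

lemma ginv_simps [simp]: "gpos (ginv g) = gpos g" "gsgn (ginv g) = - gsgn g" "ginv (ginv g) = g"
  by (cases g; simp)+

lemma aq_rel_eq: "aq_rel a b \<Longrightarrow> abs_aq a = abs_aq b"
  by (simp add: aq.abs_eq_iff aq_eq_def aq_ideal_rel)

lemma word_aq_ginv: "word_aq (Word [g]) * word_aq (Word [ginv g]) = 1"
  by (cases g) (use aq_rel_eq[OF aq_rel.X_Xi] aq_rel_eq[OF aq_rel.Xi_X] aq_rel_eq[OF aq_rel.Y_Yi]
    aq_rel_eq[OF aq_rel.Yi_Y] in
      \<open>simp_all add: word_aq_def letter_def one_aq_def flip: times_aq.abs_eq\<close>)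

lemma word_aq_rel:
  assumes "aq_rel (letter g * letter g') (scalar c * (letter g' * letter g))"
  shows "word_aq (Word [g]) * word_aq (Word [g']) = c *\<^sub>q (word_aq (Word [g']) * word_aq (Word [g]))"
  using aq_rel_eq[OF assms]
  by (simp add: word_aq_def letter_def times_aq.abs_eq smult_aq.abs_eq)

lemma qcomm_letters: "qcomm (word_aq (Word [g])) (word_aq (Word [g']))"
proof -
  have refl: "qcomm a a" for a unfolding qcomm_def by (rule exI[of _ 0]) simp
  have XX: "qcomm (word_aq (Word [X k])) (word_aq (Word [X l]))" if "k < l" for k l
    unfolding qcomm_def using word_aq_rel[OF aq_rel.X_X[OF that]] qvar_qpow by metis
  have YY: "qcomm (word_aq (Word [Y k])) (word_aq (Word [Y l]))" if "k < l" for k l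
    unfolding qcomm_def using word_aq_rel[OF aq_rel.Y_Y[OF that]] qvar_qpow by metis
  have YX: "qcomm (word_aq (Word [Y k])) (word_aq (Word [X l]))" if "k < l" for k l
    unfolding qcomm_def using word_aq_rel[OF aq_rel.Y_X[OF that]] qvar_qpow by metis
  have XY: "qcomm (word_aq (Word [X k])) (word_aq (Word [Y l]))" if "k \<le> l" for k l
    unfolding qcomm_def using word_aq_rel[OF aq_rel.X_Y[OF that]] qvar_qpow by metis
  have pos: "qcomm (word_aq (Word [g])) (word_aq (Word [g']))" if "gsgn g = 1" "gsgn g' = 1" for g g'
  proof (cases g; cases g')
    fix k l assume "g = X k" "g' = X l"
    then show ?thesis using XX[of k l] XX[of l k] refl qcomm_sym by (cases k l rule: linorder_cases) auto
  next
    fix k l assume "g = Y k" "g' = Y l"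
    then show ?thesis using YY[of k l] YY[of l k] refl qcomm_sym by (cases k l rule: linorder_cases) auto
  next
    fix k l assume "g = Y k" "g' = X l"
    then show ?thesis using YX[of k l] XY[of l k] qcomm_sym by (cases "k < l") auto
  next
    fix k l assume "g = X k" "g' = Y l"
    then show ?thesis using XY[of k l] YX[of l k] qcomm_sym by (cases "k \<le> l") auto
  qed (use that in auto)
  have inv: "qcomm (word_aq (Word [ginv g])) b" if "qcomm (word_aq (Word [g])) b" for g b
    using qcomm_inverse[OF that] word_aq_ginv[of g] word_aq_ginv[of "ginv g"] by simp
  have sgn: "gsgn g = 1 \<or> gsgn (ginv g) = 1" for g by (cases g) auto
  have half: "qcomm (word_aq (Word [g])) (word_aq (Word [g']))" if "gsgn g' = 1" for g g'
    using sgn[of g] pos[OF _ that] inv[of "ginv g"] by auto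
  show ?thesis
    using sgn[of g'] half[of g' g] half[of "ginv g'" g] inv[of "ginv g'"] qcomm_sym by (metis ginv_simps(3))
qed

lemma word_Cons: "Word (g # u) = Word [g] + Word u"
  by (simp add: plus_word_def)

lemma word_append: "Word (u @ v) = Word u + Word v"
  by (simp add: plus_word_def)

lemma qcomm_letter_word: "qcomm (word_aq (Word [g])) (word_aq w)"
proof -
  have one: "qcomm a 1" for a unfolding qcomm_def by (rule exI[of _ 0]) simp
  have "qcomm (word_aq (Word [g])) (word_aq (Word xs))" for xs
  proof (induction xs)
    case Nil
    then show ?case using one by (simp flip: zero_word_def)
  next
    case (Cons g' xs)
    then show ?case using qcomm_mult qcomm_letters by (subst word_Cons) (simp add: word_aq_plus)
  qed
  from this[of "letters w"] show ?thesis by simp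
qed

text \<open>The spanning half of the basis property. Exponent zero means that letters and inverse
  letters balance at every position, so the first letter can be moved next to an inverse of itself,
  at the cost of a power of \<open>q\<close>, and cancelled.\<close>

lemma word_aq_trivial:
  assumes "wexp w = 0"
  shows "\<exists>k. word_aq w = qpow k *\<^sub>q 1"
proof -
  have "wexp (Word xs) = 0 \<longrightarrow> (\<exists>k. word_aq (Word xs) = qpow k *\<^sub>q 1)" for xs
  proof (induction "length xs" arbitrary: xs rule: less_induct)
    case less
    show ?case
    proof (cases xs)
      case Nil
      then show ?thesis by (auto simp flip: zero_word_def intro!: exI[of _ 0])
    next
      case (Cons g u)
      show ?thesis
      proof
        assume w: "wexp (Word xs) = 0"
        \<comment> \<open>The signed number of letters at position \<open>a\<close> is recovered
          from two neighbouring entries of the exponent.\<close>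
        have mult: "wexp (Word ys) a + wexp (Word ys) (a - 1) = - (\<Sum>g\<leftarrow>ys. if gpos g = a then gsgn g else 0)" for ys a
        proof (induction ys)
          case (Cons h ys)
          have "zexp b a + zexp b (a - 1) = (if b = a then - 1 else 0)" for b
            by (cases a b rule: linorder_cases) (auto simp: zexp_def)
          from this[of "gpos h"] have "gsgn h * zexp (gpos h) a + gsgn h * zexp (gpos h) (a - 1) =
              (if gpos h = a then - gsgn h else 0)"
            by (simp flip: distrib_left)
          then show ?case using Cons by (cases "gpos h = a") (simp_all add: wexp_Word)
        qed (simp add: wexp_Word)
        have "ginv g \<in> set u"
        proof (rule ccontr)
          assume not: "ginv g \<notin> set u"
          have same: "gpos h = gpos g \<Longrightarrow> h \<noteq> ginv g \<Longrightarrow> gsgn h = gsgn g" for h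
            by (cases h; cases g) (auto, presburger+)
          have "gsgn g * (\<Sum>h\<leftarrow>ys. if gpos h = gpos g then gsgn h else 0) \<ge> 0" if "ginv g \<notin> set ys" for ys
            using that
          proof (induction ys)
            case (Cons h ys)
            then show ?case using same[of h] by (auto simp: distrib_left add_nonneg_nonneg)
          qed simp
          from this[OF not] have "gsgn g * (\<Sum>h\<leftarrow>xs. if gpos h = gpos g then gsgn h else 0) > 0"
            using Cons by (cases g) (auto simp: distrib_left)
          then show False using mult[of xs "gpos g"] w by simp
        qed
        then obtain u1 u2 where u: "u = u1 @ ginv g # u2" by (meson split_list)
        have e: "wexp (Word [g]) + wexp (Word [ginv g]) = 0"
          by (simp add: fun_eq_iff wexp_Word)
        have xs: "Word xs = Word [g] + (Word u1 + (Word [ginv g] + Word u2))"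
          unfolding Cons u by (simp add: plus_word_def)
        have "wexp (Word (u1 @ u2)) = 0"
        proof -
          have "wexp (Word (u1 @ u2)) = wexp (Word xs) - (wexp (Word [g]) + wexp (Word [ginv g]))"
            unfolding xs word_append wexp_plus by (simp only: algebra_simps)
          then show ?thesis using w e by simp
        qed
        moreover have "length (u1 @ u2) < length xs" unfolding Cons u by simp
        ultimately obtain k where k: "word_aq (Word (u1 @ u2)) = qpow k *\<^sub>q 1"
          using less by blast
        obtain j where j: "word_aq (Word [g]) * word_aq (Word u1) = qpow j *\<^sub>q (word_aq (Word u1) * word_aq (Word [g]))"
          using qcomm_letter_word[of g "Word u1"] unfolding qcomm_def by blast
        have "word_aq (Word xs) = (word_aq (Word [g]) * word_aq (Word u1)) * word_aq (Word [ginv g]) * word_aq (Word u2)"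
          unfolding xs by (simp add: word_aq_plus mult.assoc)
        also have "\<dots> = qpow j *\<^sub>q (word_aq (Word u1) * (word_aq (Word [g]) * word_aq (Word [ginv g])) * word_aq (Word u2))"
          unfolding j smult_aq_mult by (simp add: mult.assoc)
        also have "\<dots> = qpow (j + k) *\<^sub>q 1"
          using k by (simp add: word_aq_ginv word_append word_aq_plus qpow_add)
        finally show "\<exists>k. word_aq (Word xs) = qpow k *\<^sub>q 1" by blast
      qed
    qed
  qed
  from this[of "letters w"] show ?thesis using assms by simp
qed

definition winv :: "word \<Rightarrow> word" where
  "winv w = Word (map ginv (rev (letters w)))"

lemma word_aq_winv: "word_aq (winv w) * word_aq w = 1"
proof -
  have "word_aq (winv (Word xs)) * word_aq (Word xs) = 1" for xs
  proof (induction xs)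
    case Nil
    then show ?case by (simp add: winv_def)
  next
    case (Cons g xs)
    have "winv (Word (g # xs)) = winv (Word xs) + Word [ginv g]"
      by (simp add: winv_def plus_word_def)
    then have "word_aq (winv (Word (g # xs))) * word_aq (Word (g # xs)) =
        word_aq (winv (Word xs)) * (word_aq (Word [ginv g]) * word_aq (Word [ginv (ginv g)])) * word_aq (Word xs)"
      by (simp add: word_aq_plus word_Cons[of g xs] mult.assoc)
    then show ?case using Cons by (simp add: word_aq_ginv del: ginv_simps)
  qed
  from this[of "letters w"] show ?thesis by simp
qed

lemma wexp_winv: "wexp (winv w) = - wexp w"
proof -
  have "wexp (Word (map ginv (rev xs))) = - wexp (Word xs)" for xs
    by (induction xs) (simp_all add: word_append fun_eq_iff wexp_Word)
  from this[of "letters w"] show ?thesis by (simp add: winv_def)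
qed

lemma word_aq_cong:
  assumes "wexp u = wexp v"
  shows "word_aq u = qpow (kap u - kap v) *\<^sub>q word_aq v"
proof -
  have "wexp (u + winv v) = 0" using assms by (simp add: wexp_winv)
  then obtain k where "word_aq (u + winv v) = qpow k *\<^sub>q 1" using word_aq_trivial by blast
  then have "word_aq (u + winv v) * word_aq v = qpow k *\<^sub>q word_aq v"
    by (simp add: smult_aq_mult)
  then have k: "word_aq u = qpow k *\<^sub>q word_aq v"
    by (simp add: word_aq_plus mult.assoc word_aq_winv)
  \<comment> \<open>The power left open by the cancellation is identified by comparing
    coefficients.\<close>
  then have "qpow (kap u) = qpow k * qpow (kap v)"
    using assms coeffs_word[of u] coeffs_smult_word[of "qpow k" v]
    by (metis lookup_single_eq)
  then have "kap u - kap v = k" by (simp flip: qpow_add)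
  then show ?thesis using k by simp
qed

text \<open>The normalization gives coefficient 1 and makes the result independent of the chosen
  word, by \<open>word_aq_cong\<close>. For functions that are not exponents of words the value is
  arbitrary.\<close>

definition monom :: "(int \<Rightarrow> int) \<Rightarrow> aq" where
  "monom p = (let w = SOME w. wexp w = p in qpow (- kap w) *\<^sub>q word_aq w)"

lemma word_aq_monom: "word_aq w = qpow (kap w) *\<^sub>q monom (wexp w)"
proof -
  define v where "v = (SOME v. wexp v = wexp w)"
  have "wexp v = wexp w" unfolding v_def by (rule someI[of _ w]) simp
  then have "word_aq w = qpow (kap w - kap v) *\<^sub>q word_aq v" by (intro word_aq_cong) simp
  then show ?thesis
    unfolding monom_def Let_def by (simp add: v_def diff_conv_add_uminus del: add_uminus_conv_diff flip: qpow_add)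
qed

definition expansion :: "coeffs \<Rightarrow> aq" where
  "expansion f = (\<Sum>p\<in>Poly_Mapping.keys f. Poly_Mapping.lookup f p *\<^sub>q monom p)"

lemma expansion_superset:
  assumes "finite S" "Poly_Mapping.keys f \<subseteq> S"
  shows "expansion f = (\<Sum>p\<in>S. Poly_Mapping.lookup f p *\<^sub>q monom p)"
  unfolding expansion_def using assms
  by (intro sum.mono_neutral_left) (auto simp: in_keys_iff)

lemma expansion_add: "expansion (f + g) = expansion f + expansion g"
proof -
  let ?S = "Poly_Mapping.keys f \<union> Poly_Mapping.keys g"
  have "expansion (f + g) = (\<Sum>p\<in>?S. Poly_Mapping.lookup (f + g) p *\<^sub>q monom p)"
    using Poly_Mapping.keys_add[of f g] by (intro expansion_superset) auto
  also have "\<dots> = expansion f + expansion g"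
    by (simp add: expansion_superset[where S = ?S] lookup_add aq.scale_left_distrib sum.distrib)
  finally show ?thesis .
qed

lemma expansion_coeffs: "expansion (coeffs a) = a"
proof (induction a rule: aq_word_induct)
  case zero
  then show ?case by (simp add: expansion_def)
next
  case (word c w)
  have "expansion (coeffs (c *\<^sub>q word_aq w)) = c *\<^sub>q (qpow (kap w) *\<^sub>q monom (wexp w))"
    unfolding coeffs_smult_word by (simp add: expansion_def)
  then show ?case by (simp flip: word_aq_monom)
next
  case (add a b)
  then show ?case by (simp add: coeffs_add expansion_add)
qed

lemma coeffs_inject: "coeffs a = coeffs b \<longleftrightarrow> a = b"
  by (metis expansion_coeffs)

text \<open>Torsion-freeness of \<open>A_q\<close>, read off coefficientwise.\<close>

lemma smult_aq_cancel:
  assumes "c *\<^sub>q a = c *\<^sub>q b" "c \<noteq> 0"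
  shows "a = b"
proof -
  have "Poly_Mapping.lookup (coeffs a) p = Poly_Mapping.lookup (coeffs b) p" for p
    using assms lookup_coeffs_smult[of c a p] lookup_coeffs_smult[of c b p] by simp
  then have "coeffs a = coeffs b" by (rule poly_mapping_eqI)
  then show ?thesis by (simp add: coeffs_inject)
qed

lemma qvar_minus_1_nonzero: "qvar - 1 \<noteq> 0"
  by (simp add: qvar_qpow)

section \<open>The graded pieces\<close>

lemma subspace_aq_deg: "aq.subspace (aq_deg n)"
  unfolding aq_deg_def by (rule aq.subspace_span)

lemmas aq_deg_0 [simp] = aq.subspace_0[OF subspace_aq_deg]
lemmas aq_deg_add = aq.subspace_add[OF subspace_aq_deg]
lemmas aq_deg_diff = aq.subspace_diff[OF subspace_aq_deg]
lemmas aq_deg_smult = aq.subspace_scale[OF subspace_aq_deg]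

lemma aq_deg_word: "word_aq w \<in> aq_deg (word_deg w)"
  unfolding aq_deg_def by (rule aq.span_base) auto

lemma aq_deg_induct [consumes 1, case_names zero word add]:
  assumes "a \<in> aq_deg n"
    and "P 0" "\<And>c w. word_deg w = n \<Longrightarrow> P (c *\<^sub>q word_aq w)"
    and "\<And>a b. a \<in> aq_deg n \<Longrightarrow> b \<in> aq_deg n \<Longrightarrow> P a \<Longrightarrow> P b \<Longrightarrow> P (a + b)"
  shows "P a"
proof -
  have "a \<in> aq_deg n \<and> P a"
    using assms(1) unfolding aq_deg_def
  proof (induction rule: aq.span_induct_alt)
    case base
    then show ?case using assms(2) by (simp add: aq.span_zero)
  next
    case (step c x y)
    then obtain w where w: "x = word_aq w" "word_deg w = n" by auto
    have "c *\<^sub>q x \<in> aq_deg n" unfolding w using w(2) aq_deg_word by (auto intro: aq_deg_smult)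
    moreover have "P (c *\<^sub>q x)" using w assms(3) by simp
    ultimately show ?case using step assms(4)[of "c *\<^sub>q x" y] aq_deg_add unfolding aq_deg_def by blast
  qed
  then show ?thesis by simp
qed

lemma coeffs_aq_deg:
  assumes "a \<in> aq_deg n" "Poly_Mapping.lookup (coeffs a) p \<noteq> 0"
  shows "\<exists>w. wexp w = p \<and> word_deg w = n"
  using assms
proof (induction rule: aq_deg_induct)
  case (word c w)
  then show ?case by (auto simp: coeffs_smult_word lookup_single when_def split: if_splits)
next
  case (add a b)
  then show ?case by (auto simp: coeffs_add lookup_add) (metis add_cancel_right_left)
qed simp

lemma shift_zero [simp]: "shift i 0 = 0"
  using shift_diff[of i 0 0] by simp

lemma shift_aq_deg: "a \<in> aq_deg n \<Longrightarrow> shift i a \<in> aq_deg n"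
proof (induction rule: aq_deg_induct)
  case (word c w)
  then show ?case using aq_deg_word[of "shift_word i w"]
    by (simp add: shift_smult shift_word_aq word_deg_shift aq_deg_smult)
qed (simp_all add: shift_add aq_deg_add)

section \<open>The flow of a density\<close>

definition comm :: "aq \<Rightarrow> aq \<Rightarrow> aq" where
  "comm a b = a * b - b * a"

lemma comm_add: "comm (a + a') b = comm a b + comm a' b" "comm a (b + b') = comm a b + comm a b'"
  by (simp_all add: comm_def algebra_simps)

lemma comm_zero [simp]: "comm 0 b = 0" "comm a 0 = 0"
  by (simp_all add: comm_def)

lemma comm_smult: "comm (c *\<^sub>q a) b = c *\<^sub>q comm a b" "comm a (c *\<^sub>q b) = c *\<^sub>q comm a b"
  by (simp_all add: comm_def smult_aq_mult aq.scale_right_diff_distrib)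

lemma comm_mult: "comm a (b * c) = comm a b * c + b * comm a c"
  by (simp add: comm_def algebra_simps)

lemma shift_comm: "shift i (comm a b) = comm (shift i a) (shift i b)"
  by (simp add: comm_def shift_diff shift_mult)

lemma comm_word: "comm (word_aq u) (word_aq v) = (qpow (kap (u + v)) - qpow (kap (v + u))) *\<^sub>q monom (wexp (u + v))"
proof -
  have "wexp (v + u) = wexp (u + v)" by (simp add: add.commute)
  then have "comm (word_aq u) (word_aq v) =
      qpow (kap (u + v)) *\<^sub>q monom (wexp (u + v)) - qpow (kap (v + u)) *\<^sub>q monom (wexp (u + v))"
    unfolding comm_def by (simp only: flip: word_aq_plus) (simp only: word_aq_monom)
  then show ?thesis by (simp add: aq.scale_left_diff_distrib)
qed

lemma qvar_minus_1_dvd: "(qvar - 1) dvd (qpow k - 1)"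
proof (induction k rule: int_induct[where k = 0])
  case base
  then show ?case by simp
next
  case (step1 i)
  have "qpow (i + 1) - 1 = qvar * (qpow i - 1) + (qvar - 1)"
    by (simp add: qpow_add qvar_qpow algebra_simps)
  then show ?case using step1 by (simp only: dvd_add dvd_mult dvd_refl)
next
  case (step2 i)
  have "qpow (i - 1) - 1 = qinv * (qpow i - 1) - qinv * (qvar - 1)"
    using qpow_add[of i "- 1"] by (simp add: qvar_qpow algebra_simps flip: qpow_add)
  then show ?case using step2 by (simp only: dvd_diff dvd_mult dvd_refl)
qed

text \<open>Two words commute up to a power of \<open>q\<close>, and \<open>qpow k - 1\<close> is
  divisible by \<open>q - 1\<close>.\<close>

lemma comm_divisible:
  assumes "a \<in> aq_deg m" "b \<in> aq_deg n"
  shows "\<exists>R\<in>aq_deg (m + n). comm a b = (qvar - 1) *\<^sub>q R"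
  using assms(1)
proof (induction rule: aq_deg_induct)
  case zero
  then show ?case by (intro bexI[of _ 0]) auto
next
  case (word c u)
  show ?case using assms(2)
  proof (induction rule: aq_deg_induct)
    case zero
    then show ?case by (intro bexI[of _ 0]) auto
  next
    case (word d v)
    have "word_aq (u + v) = qpow (kap (u + v) - kap (v + u)) *\<^sub>q word_aq (v + u)"
      by (rule word_aq_cong) (simp add: add.commute)
    moreover obtain r where r: "qpow (kap (u + v) - kap (v + u)) - 1 = (qvar - 1) * r"
      using qvar_minus_1_dvd by blast
    ultimately have "comm (word_aq u) (word_aq v) = (qvar - 1) *\<^sub>q (r *\<^sub>q word_aq (v + u))"
      unfolding comm_def by (simp flip: word_aq_plus r add: aq.scale_left_diff_distrib)
    then have "comm (c *\<^sub>q word_aq u) (d *\<^sub>q word_aq v) = (qvar - 1) *\<^sub>q ((c * d * r) *\<^sub>q word_aq (v + u))"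
      by (simp add: comm_smult ac_simps)
    moreover have "(c * d * r) *\<^sub>q word_aq (v + u) \<in> aq_deg (m + n)"
      using aq_deg_word[of "v + u"] \<open>word_deg u = m\<close> word by (auto simp: add.commute intro: aq_deg_smult)
    ultimately show ?case by blast
  next
    case (add a b)
    then obtain R S where "R \<in> aq_deg (m + n)" "S \<in> aq_deg (m + n)"
      "comm (c *\<^sub>q word_aq u) a = (qvar - 1) *\<^sub>q R" "comm (c *\<^sub>q word_aq u) b = (qvar - 1) *\<^sub>q S" by blast
    then show ?case by (intro bexI[of _ "R + S"]) (auto simp: comm_add aq.scale_right_distrib aq_deg_add)
  qed
next
  case (add a a')
  then obtain R S where "R \<in> aq_deg (m + n)" "S \<in> aq_deg (m + n)"
    "comm a b = (qvar - 1) *\<^sub>q R" "comm a' b = (qvar - 1) *\<^sub>q S" by blast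
  then show ?case by (intro bexI[of _ "R + S"]) (auto simp: comm_add aq.scale_right_distrib aq_deg_add)
qed

lemma kap_swap:
  assumes "word_deg u = 0"
  shows "kap (u + v) - kap (v + u) = wpair (\<lambda>a. wexp u (a - 1)) v - wpair (wexp u) v"
  using assms by (simp add: kap_plus wpair_swap[of v u])

lemma finite_comm_shift:
  assumes "P \<in> aq_deg 0"
  shows "finite {i. comm (shift i P) a \<noteq> 0}"
  using assms
proof (induction rule: aq_deg_induct)
  case (word c u)
  show ?case
  proof (induction a rule: aq_word_induct)
    case (word d v)
    let ?f = "wexp u"
    have fin: "finite {x. ?f x \<noteq> 0}" using \<open>word_deg u = 0\<close> finite_wexp_iff by blast
    \<comment> \<open>This set contains the shifts that bring a nonzero entry of
      \<open>wexp u\<close> to the position of a letter of \<open>v\<close> or to the one just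
      before it. For all others both pairings in \<open>kap_swap\<close> vanish.\<close>
    let ?B = "\<Union>g\<in>set (letters v). \<Union>x\<in>{x. ?f x \<noteq> 0}. {(gpos g - x) div 2, (gpos g - 1 - x) div 2}"
    have "comm (word_aq (shift_word i u)) (word_aq v) = 0" if "i \<notin> ?B" for i
    proof -
      have "?f (gpos g - 2 * i) = 0" "?f (gpos g - 1 - 2 * i) = 0" if "g \<in> set (letters v)" for g
        using \<open>i \<notin> ?B\<close> that by force+
      then have "wpair (wexp (shift_word i u)) v = 0" "wpair (\<lambda>a. wexp (shift_word i u) (a - 1)) v = 0"
        unfolding wpair_def wexp_shift texp_def by (simp_all cong: map_cong)
      then have "kap (shift_word i u + v) = kap (v + shift_word i u)"
        using kap_swap[of "shift_word i u" v] \<open>word_deg u = 0\<close> by (simp add: word_deg_shift)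
      then show ?thesis by (simp add: comm_word)
    qed
    then have "comm (shift i (c *\<^sub>q word_aq u)) (d *\<^sub>q word_aq v) = 0" if "i \<notin> ?B" for i
      by (simp only: shift_smult shift_word_aq comm_smult that not_False_eq_True aq.scale_zero_right)
    then have "{i. comm (shift i (c *\<^sub>q word_aq u)) (d *\<^sub>q word_aq v) \<noteq> 0} \<subseteq> ?B"
      by blast
    then show ?case by (rule finite_subset) (use fin in simp)
  next
    case (add a b)
    then have "finite ({i. comm (shift i (c *\<^sub>q word_aq u)) a \<noteq> 0} \<union> {i. comm (shift i (c *\<^sub>q word_aq u)) b \<noteq> 0})"
      by simp
    then show ?case by (rule rev_finite_subset) (auto simp: comm_add)
  qed simp
next
  case (add P Q)
  then have "finite ({i. comm (shift i P) a \<noteq> 0} \<union> {i. comm (shift i Q) a \<noteq> 0})" by simp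
  then show ?case by (rule rev_finite_subset) (auto simp: shift_add comm_add)
qed simp

lemma additive_Sum_any:
  fixes g :: "'a::ab_group_add \<Rightarrow> 'b::ab_group_add"
  assumes "\<And>x y. g (x + y) = g x + g y" "finite {i. f i \<noteq> 0}"
  shows "g (Sum_any f) = Sum_any (\<lambda>i. g (f i))"
proof -
  have zero: "g 0 = 0" using assms(1)[of 0 0] by simp
  have "g (sum f S) = (\<Sum>i\<in>S. g (f i))" if "finite S" for S
    using that by induction (simp_all add: zero assms(1))
  moreover have "{i. g (f i) \<noteq> 0} \<subseteq> {i. f i \<noteq> 0}" using zero by auto
  ultimately show ?thesis
    using assms(2) by (simp add: Sum_any.expand_set[of f] Sum_any.expand_superset[of "{i. f i \<noteq> 0}"])
qed

text \<open>For \<open>P\<close> of degree 0 this is \<open>q - 1\<close> times the bracket with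
  \<open>P\<close> before passing to classes: a derivation of \<open>A_q\<close> that commutes with
  the shift and depends only on the class of \<open>P\<close>.\<close>

definition flow :: "aq \<Rightarrow> aq \<Rightarrow> aq" where
  "flow P a = Sum_any (\<lambda>i::int. comm (shift i P) a)"

lemma flow_add_right: "P \<in> aq_deg 0 \<Longrightarrow> flow P (a + b) = flow P a + flow P b"
  unfolding flow_def comm_add by (intro Sum_any.distrib finite_comm_shift)

lemma flow_add_left: "P \<in> aq_deg 0 \<Longrightarrow> Q \<in> aq_deg 0 \<Longrightarrow> flow (P + Q) a = flow P a + flow Q a"
  unfolding flow_def comm_add shift_add by (intro Sum_any.distrib finite_comm_shift)

lemma flow_diff_right: "P \<in> aq_deg 0 \<Longrightarrow> flow P (a - b) = flow P a - flow P b"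
  using flow_add_right[of P "a - b" b] by simp

lemma flow_diff_left: "P \<in> aq_deg 0 \<Longrightarrow> Q \<in> aq_deg 0 \<Longrightarrow> flow (P - Q) a = flow P a - flow Q a"
  using flow_add_left[of "P - Q" Q a] aq_deg_diff by simp

lemma flow_zero [simp]: "flow 0 a = 0" "flow P 0 = 0"
  by (simp_all add: flow_def)

lemma flow_smult:
  assumes "P \<in> aq_deg 0"
  shows "flow P (c *\<^sub>q a) = c *\<^sub>q flow P a" "flow (c *\<^sub>q P) a = c *\<^sub>q flow P a"
  unfolding flow_def shift_smult comm_smult
  by (rule additive_Sum_any[symmetric]; simp add: aq.scale_right_distrib finite_comm_shift assms)+

lemma flow_mult:
  assumes "P \<in> aq_deg 0"
  shows "flow P (a * b) = flow P a * b + a * flow P b"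
proof -
  have fin: "finite {i. comm (shift i P) a * b \<noteq> 0}" "finite {i. a * comm (shift i P) b \<noteq> 0}"
    by (rule finite_subset[OF _ finite_comm_shift[OF assms, of a]], auto)
      (rule finite_subset[OF _ finite_comm_shift[OF assms, of b]], auto)
  have "flow P (a * b) = Sum_any (\<lambda>i. comm (shift i P) a * b) + Sum_any (\<lambda>i. a * comm (shift i P) b)"
    unfolding flow_def comm_mult by (rule Sum_any.distrib[OF fin])
  then show ?thesis
    unfolding flow_def by (simp add: Sum_any_left_distrib Sum_any_right_distrib finite_comm_shift assms)
qed

lemma flow_comm:
  assumes "P \<in> aq_deg 0"
  shows "flow P (comm a b) = comm (flow P a) b + comm a (flow P b)"
  unfolding comm_def flow_diff_right[OF assms] flow_mult[OF assms] by (simp add: algebra_simps)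

lemma flow_shift_left: "flow (shift j P) a = flow P a"
proof -
  have "bij (\<lambda>i. i + j)" by (rule bij_plus_right)
  then show ?thesis unfolding flow_def
    by (rule Sum_any.reindex_cong[symmetric]) (simp add: fun_eq_iff shift_shift)
qed

lemma shift_flow:
  assumes "P \<in> aq_deg 0"
  shows "shift j (flow P a) = flow P (shift j a)"
proof -
  have "shift j (flow P a) = Sum_any (\<lambda>i. shift j (comm (shift i P) a))"
    unfolding flow_def by (rule additive_Sum_any) (simp_all add: shift_add finite_comm_shift assms)
  also have "\<dots> = flow (shift j P) (shift j a)"
    unfolding flow_def shift_comm shift_shift by (simp add: add.commute)
  finally show ?thesis by (simp add: flow_shift_left)
qed

lemma flow_divisible:
  assumes "P \<in> aq_deg 0" "a \<in> aq_deg n"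
  shows "\<exists>R\<in>aq_deg n. flow P a = (qvar - 1) *\<^sub>q R"
proof -
  have "\<exists>R\<in>aq_deg n. (\<Sum>i\<in>S. comm (shift i P) a) = (qvar - 1) *\<^sub>q R" if "finite S" for S :: "int set"
    using that
  proof induction
    case empty
    then show ?case by (intro bexI[of _ 0]) auto
  next
    case (insert i S)
    obtain R where R: "R \<in> aq_deg n" "comm (shift i P) a = (qvar - 1) *\<^sub>q R"
      using comm_divisible[OF shift_aq_deg[OF assms(1)] assms(2)] by auto
    from insert obtain R' where "R' \<in> aq_deg n" "(\<Sum>i\<in>S. comm (shift i P) a) = (qvar - 1) *\<^sub>q R'" by blast
    then show ?case using R insert
      by (intro bexI[of _ "R + R'"]) (auto simp: aq.scale_right_distrib aq_deg_add)
  qed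
  then show ?thesis unfolding flow_def
    using finite_comm_shift[OF assms(1)] by (simp add: Sum_any.expand_set)
qed

lemma bracket_rep:
  assumes "P \<in> aq_deg 0" "a \<in> aq_deg n"
  shows "(qvar - 1) *\<^sub>q bracket_rep P a = flow P a" "bracket_rep P a \<in> aq_deg n"
proof -
  obtain R where R: "R \<in> aq_deg n" "flow P a = (qvar - 1) *\<^sub>q R"
    using flow_divisible[OF assms] by blast
  have "bracket_rep P a = R"
    unfolding bracket_rep_def
  proof (rule the_equality)
    show "(qvar - 1) *\<^sub>q R = (\<Sum>i. shift i P * a - a * shift i P)"
      using R(2) unfolding flow_def comm_def by simp
    fix S assume "(qvar - 1) *\<^sub>q S = (\<Sum>i. shift i P * a - a * shift i P)"
    then have "(qvar - 1) *\<^sub>q S = (qvar - 1) *\<^sub>q R"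
      using R(2) unfolding flow_def comm_def by simp
    then show "S = R" using qvar_minus_1_nonzero by (rule smult_aq_cancel)
  qed
  then show "(qvar - 1) *\<^sub>q bracket_rep P a = flow P a" "bracket_rep P a \<in> aq_deg n"
    using R by simp_all
qed

text \<open>The Jacobi identity, stated for the derivations defined by densities, so that no double sums
  over translates occur.\<close>

lemma flow_flow:
  assumes "P \<in> aq_deg 0" "Q \<in> aq_deg 0"
  shows "flow (flow P Q) a = flow P (flow Q a) - flow Q (flow P a)"
proof -
  have fin: "finite {j. flow P (comm (shift j Q) a) \<noteq> 0}" "finite {j. comm (shift j Q) (flow P a) \<noteq> 0}"
    by (rule finite_subset[OF _ finite_comm_shift[OF assms(2), of a]]; auto)
      (rule finite_comm_shift[OF assms(2)])
  have fin': "finite {j. - comm (shift j Q) (flow P a) \<noteq> 0}" using fin(2) by simp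
  have "flow (flow P Q) a = Sum_any (\<lambda>j. comm (flow P (shift j Q)) a)"
    unfolding flow_def[of "flow P Q"] shift_flow[OF assms(1)] ..
  also have "\<dots> = Sum_any (\<lambda>j. flow P (comm (shift j Q) a) + - comm (shift j Q) (flow P a))"
    by (simp add: flow_comm[OF assms(1)])
  also have "\<dots> = Sum_any (\<lambda>j. flow P (comm (shift j Q) a)) + Sum_any (\<lambda>j. - comm (shift j Q) (flow P a))"
    by (rule Sum_any.distrib[OF fin(1) fin'])
  also have "Sum_any (\<lambda>j. flow P (comm (shift j Q) a)) = flow P (flow Q a)"
    unfolding flow_def[of Q]
    by (rule additive_Sum_any[symmetric]) (simp_all add: flow_add_right finite_comm_shift assms)
  also have "Sum_any (\<lambda>j. - comm (shift j Q) (flow P a)) = - flow Q (flow P a)"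
    unfolding flow_def[of Q]
    by (rule additive_Sum_any[symmetric]) (simp_all add: fin)
  finally show ?thesis by simp
qed

section \<open>Operations on classes in terms of representatives\<close>

lemma cls_mem: "P \<in> aq_deg n \<Longrightarrow> P \<in> cls n P"
  using equiv_class_self[OF equiv_shift_rel] by (simp add: cls_def)

lemma cls_eq_iff:
  assumes "P \<in> aq_deg n" "Q \<in> aq_deg n"
  shows "cls n P = cls n Q \<longleftrightarrow> (\<exists>R\<in>aq_deg n. P - Q = shift 1 R - R)"
  using assms eq_equiv_class_iff[OF equiv_shift_rel assms]
  by (auto simp: cls_def shift_rel_def)

lemma cls_memD:
  assumes "Q \<in> cls n P"
  shows "P \<in> aq_deg n" "Q \<in> aq_deg n" "cls n Q = cls n P"
  using assms equiv_class_eq[OF equiv_shift_rel, of P Q n] by (auto simp: cls_def shift_rel_def)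

lemma Floc_cls: "P \<in> aq_deg n \<Longrightarrow> cls n P \<in> Floc n"
  by (simp add: Floc_def cls_def quotientI)

lemma Floc_obtain:
  assumes "U \<in> Floc n"
  obtains P where "P \<in> aq_deg n" "U = cls n P"
  using assms by (auto simp: Floc_def cls_def elim: quotientE)

lemma UN2_constant:
  assumes "x \<in> U" "y \<in> V" "\<And>x y. x \<in> U \<Longrightarrow> y \<in> V \<Longrightarrow> f x y = c"
  shows "(\<Union>x\<in>U. \<Union>y\<in>V. f x y) = c"
proof -
  have "(\<Union>x\<in>U. \<Union>y\<in>V. f x y) = (\<Union>x\<in>U. \<Union>y\<in>V. c)" using assms(3) by simp
  then show ?thesis using assms(1,2) by auto
qed

lemma add_Floc_cls:
  assumes "P \<in> aq_deg n" "Q \<in> aq_deg n"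
  shows "add_Floc n (cls n P) (cls n Q) = cls n (P + Q)"
proof -
  have "cls n (P' + Q') = cls n (P + Q)" if P': "P' \<in> cls n P" and Q': "Q' \<in> cls n Q" for P' Q'
  proof -
    note P' = cls_memD[OF P'] and Q' = cls_memD[OF Q']
    obtain R S where "R \<in> aq_deg n" "P' - P = shift 1 R - R" "S \<in> aq_deg n" "Q' - Q = shift 1 S - S"
      using P' Q' assms by (auto simp: cls_eq_iff)
    then have "P' + Q' - (P + Q) = shift 1 (R + S) - (R + S)" "R + S \<in> aq_deg n"
      by (simp_all add: shift_add aq_deg_add algebra_simps)
    then show ?thesis using P' Q' assms by (auto simp: cls_eq_iff aq_deg_add)
  qed
  then show ?thesis
    unfolding add_Floc_def using assms by (intro UN2_constant[of P _ Q]) (auto intro: cls_mem)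
qed

lemma smult_Floc_cls:
  assumes "P \<in> aq_deg n"
  shows "smult_Floc n c (cls n P) = cls n (c *\<^sub>q P)"
proof -
  have "cls n (c *\<^sub>q P') = cls n (c *\<^sub>q P)" if P': "P' \<in> cls n P" for P'
  proof -
    note P' = cls_memD[OF P']
    obtain R where "R \<in> aq_deg n" "P' - P = shift 1 R - R"
      using P' assms by (auto simp: cls_eq_iff)
    then have "c *\<^sub>q P' - c *\<^sub>q P = shift 1 (c *\<^sub>q R) - c *\<^sub>q R" "c *\<^sub>q R \<in> aq_deg n"
      by (simp_all add: shift_smult aq_deg_smult flip: aq.scale_right_diff_distrib)
    then show ?thesis using P' assms by (auto simp: cls_eq_iff aq_deg_smult)
  qed
  then show ?thesis using cls_mem assms unfolding smult_Floc_def by blast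
qed

lemma flow_cls:
  assumes "cls 0 P = cls 0 Q" "P \<in> aq_deg 0" "Q \<in> aq_deg 0"
  shows "flow P a = flow Q a"
proof -
  obtain R where R: "R \<in> aq_deg 0" "P - Q = shift 1 R - R" using assms by (auto simp: cls_eq_iff)
  have "flow P a - flow Q a = flow (shift 1 R) a - flow R a"
    using R assms by (simp flip: flow_diff_left add: shift_aq_deg)
  then show ?thesis by (simp add: flow_shift_left)
qed

text \<open>The flow depends only on the class of \<open>P\<close> and commutes with the shift, so
  it sends a total difference in the second argument to a total difference. The comparison is made
  after multiplication by \<open>q - 1\<close>.\<close>

lemma bracket_cls:
  assumes "P \<in> aq_deg 0" "a \<in> aq_deg n"
  shows "bracket n (cls 0 P) (cls n a) = cls n (bracket_rep P a)"
proof -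
  have "cls n (bracket_rep P' a') = cls n (bracket_rep P a)" if P': "P' \<in> cls 0 P" and a': "a' \<in> cls n a" for P' a'
  proof -
    note P' = cls_memD[OF P'] and a' = cls_memD[OF a']
    obtain S where S: "S \<in> aq_deg n" "a' - a = shift 1 S - S"
      using a' assms by (auto simp: cls_eq_iff)
    have "(qvar - 1) *\<^sub>q (bracket_rep P' a' - bracket_rep P a) = flow P a' - flow P a"
      using P' a' assms by (simp add: aq.scale_right_diff_distrib bracket_rep flow_cls[of P' P])
    also have "\<dots> = (qvar - 1) *\<^sub>q (shift 1 (bracket_rep P S) - bracket_rep P S)"
      using S assms
      by (simp add: aq.scale_right_diff_distrib bracket_rep shift_flow flip: flow_diff_right shift_smult)
    finally have "bracket_rep P' a' - bracket_rep P a = shift 1 (bracket_rep P S) - bracket_rep P S"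
      using qvar_minus_1_nonzero by (rule smult_aq_cancel)
    then show ?thesis
      using P' a' S assms bracket_rep(2)[of P] bracket_rep(2)[of P'] by (auto simp: cls_eq_iff)
  qed
  then show ?thesis
    unfolding bracket_def using assms by (intro UN2_constant[of P _ a]) (auto intro: cls_mem)
qed

section \<open>The screening condition on densities\<close>

definition screened_by :: "int \<Rightarrow> aq \<Rightarrow> aq \<Rightarrow> bool" where
  "screened_by n z P \<longleftrightarrow> (\<exists>R\<in>aq_deg n. flow P z = (qvar - 1) *\<^sub>q (shift 1 R - R))"

lemma bracket_cls_eq_0:
  assumes "P \<in> aq_deg 0" "z \<in> aq_deg n"
  shows "bracket n (cls 0 P) (cls n z) = cls n 0 \<longleftrightarrow> screened_by n z P"
proof -
  have "flow P z = (qvar - 1) *\<^sub>q (shift 1 R - R) \<longleftrightarrow> bracket_rep P z = shift 1 R - R" for R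
    using bracket_rep(1)[OF assms] smult_aq_cancel[OF _ qvar_minus_1_nonzero] by metis
  then show ?thesis
    using assms bracket_rep(2)[OF assms] by (simp add: bracket_cls cls_eq_iff screened_by_def)
qed

lemma screened_by_add:
  assumes "P \<in> aq_deg 0" "Q \<in> aq_deg 0" "screened_by n z P" "screened_by n z Q"
  shows "screened_by n z (P + Q)"
proof -
  obtain R S where "R \<in> aq_deg n" "flow P z = (qvar - 1) *\<^sub>q (shift 1 R - R)"
    "S \<in> aq_deg n" "flow Q z = (qvar - 1) *\<^sub>q (shift 1 S - S)"
    using assms unfolding screened_by_def by blast
  moreover have "shift 1 R - R + (shift 1 S - S) = shift 1 (R + S) - (R + S)"
    by (simp add: shift_add)
  ultimately have "flow (P + Q) z = (qvar - 1) *\<^sub>q (shift 1 (R + S) - (R + S))" "R + S \<in> aq_deg n"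
    by (simp_all only: flow_add_left[OF assms(1,2)] aq_deg_add flip: aq.scale_right_distrib)
  then show ?thesis unfolding screened_by_def by blast
qed

lemma screened_by_smult:
  assumes "P \<in> aq_deg 0" "screened_by n z P"
  shows "screened_by n z (c *\<^sub>q P)"
proof -
  obtain R where "R \<in> aq_deg n" "flow P z = (qvar - 1) *\<^sub>q (shift 1 R - R)"
    using assms unfolding screened_by_def by blast
  then show ?thesis unfolding screened_by_def
    by (intro bexI[of _ "c *\<^sub>q R"])
      (simp_all add: flow_smult assms shift_smult aq_deg_smult mult.commute flip: aq.scale_right_diff_distrib)
qed

lemma screened_by_bracket_rep:
  assumes P: "P \<in> aq_deg 0" "screened_by n z P" and Q: "Q \<in> aq_deg 0" "screened_by n z Q"
  shows "screened_by n z (bracket_rep P Q)"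
proof -
  obtain R S where R: "R \<in> aq_deg n" "flow P z = (qvar - 1) *\<^sub>q (shift 1 R - R)"
    and S: "S \<in> aq_deg n" "flow Q z = (qvar - 1) *\<^sub>q (shift 1 S - S)"
    using P Q unfolding screened_by_def by blast
  \<comment> \<open>By the Jacobi identity the flow of the bracket on \<open>z\<close> is a
    commutator of flows. Applied to the total differences of \<open>S\<close> and \<open>R\<close>,
    which commute with flows, it gives the total difference of \<open>V\<close> with a factor
    \<open>(q - 1)\<close> squared, one of which is cancelled.\<close>
  define V where "V = bracket_rep P S - bracket_rep Q R"
  have V: "V \<in> aq_deg n" using P Q R S by (simp add: V_def bracket_rep aq_deg_diff)
  have K: "bracket_rep P Q \<in> aq_deg 0" using P Q by (intro bracket_rep)
  have T: "flow A ((qvar - 1) *\<^sub>q (shift 1 B - B)) =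
      (qvar - 1) *\<^sub>q (qvar - 1) *\<^sub>q (shift 1 (bracket_rep A B) - bracket_rep A B)"
    if "A \<in> aq_deg 0" "B \<in> aq_deg n" for A B
  proof -
    have "flow A ((qvar - 1) *\<^sub>q (shift 1 B - B)) = (qvar - 1) *\<^sub>q (shift 1 (flow A B) - flow A B)"
      using that by (simp add: flow_smult flow_diff_right shift_flow)
    also have "flow A B = (qvar - 1) *\<^sub>q bracket_rep A B" using that by (simp add: bracket_rep)
    finally show ?thesis by (simp only: shift_smult aq.scale_right_diff_distrib)
  qed
  have "(qvar - 1) *\<^sub>q flow (bracket_rep P Q) z = flow (flow P Q) z"
    using P Q K by (simp add: bracket_rep flip: flow_smult(2))
  also have "\<dots> = flow P (flow Q z) - flow Q (flow P z)" using P Q by (simp add: flow_flow)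
  also have "\<dots> = (qvar - 1) *\<^sub>q (qvar - 1) *\<^sub>q (shift 1 V - V)"
    unfolding R S T[OF P(1) S(1)] T[OF Q(1) R(1)] V_def
    by (simp only: shift_diff aq.scale_right_diff_distrib) (simp only: algebra_simps)
  finally have "flow (bracket_rep P Q) z = (qvar - 1) *\<^sub>q (shift 1 V - V)"
    using qvar_minus_1_nonzero by (rule smult_aq_cancel)
  then show ?thesis using V unfolding screened_by_def by blast
qed

section \<open>Orbit sums\<close>

abbreviation coef :: "aq \<Rightarrow> (int \<Rightarrow> int) \<Rightarrow> laurent" where
  "coef a \<equiv> Poly_Mapping.lookup (coeffs a)"

lemma coef_support_left:
  assumes "coef a p \<noteq> 0"
  shows "\<exists>w. wexp w = p"
  using assms
proof (induction a rule: aq_word_induct)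
  case (word c w)
  then show ?case by (auto simp: coeffs_smult_word lookup_single when_def split: if_splits)
next
  case (add a b)
  then show ?case by (auto simp: coeffs_add lookup_add) (metis add_cancel_right_left)
qed simp

lemma wexp_vanishes_left: "\<exists>A. \<forall>x<A. wexp w x = 0"
proof -
  obtain A B where "\<forall>g\<in>set (letters w). A < gpos g \<and> gpos g \<le> B"
    using letters_bounded by blast
  then have "\<forall>x<A. wexp w x = 0" by (intro allI impI wexp_left) force
  then show ?thesis by blast
qed

text \<open>Two equal translates would make \<open>p\<close> periodic, and a periodic function
  vanishing far to the left is zero.\<close>

lemma inj_texp:
  assumes "p \<noteq> 0" "\<forall>x<A. p x = 0"
  shows "inj (\<lambda>i. texp i p)"
proof (rule injI)
  have less: False if "texp i p = texp j p" "i < j" for i j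
  proof -
    have "texp (- i) (texp j p) = texp (- i) (texp i p)" using that by simp
    then have period: "texp (j - i) p = p" by simp
    have "p x = p (x - 2 * (j - i) * int n)" for n x
    proof (induction n)
      case (Suc n)
      have "p (x - 2 * (j - i) * int n) = p (x - 2 * (j - i) * int n - 2 * (j - i))"
        using fun_cong[OF period, of "x - 2 * (j - i) * int n"] by (simp add: texp_def)
      then show ?case using Suc by (simp add: algebra_simps)
    qed simp
    note per = this
    have "p x = 0" for x
    proof -
      have "int (nat (\<bar>x - A\<bar> + 1)) \<le> 2 * (j - i) * int (nat (\<bar>x - A\<bar> + 1))"
        using that by (simp add: mult_le_cancel_right1)
      then have "x - 2 * (j - i) * int (nat (\<bar>x - A\<bar> + 1)) < A" by linarith
      then show ?thesis using per[of x "nat (\<bar>x - A\<bar> + 1)"] assms(2) by simp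
    qed
    then show False using assms(1) by (simp add: fun_eq_iff)
  qed
  fix i j assume "texp i p = texp j p"
  then show "i = j" using less[of i j] less[of j i] by (cases i j rule: linorder_cases) auto
qed

lemma finite_orbit:
  assumes "p \<noteq> 0"
  shows "finite {i. coef a (texp i p) \<noteq> 0}"
proof (cases "\<exists>i. coef a (texp i p) \<noteq> 0")
  case True
  then obtain i w where "texp i p = wexp w" using coef_support_left by metis
  then obtain A where A: "\<forall>x<A. p (x - 2 * i) = 0"
    using wexp_vanishes_left[of w] by (metis texp_def)
  have "\<forall>x<A - 2 * i. p x = 0"
  proof (intro allI impI)
    fix x assume "x < A - 2 * i"
    then show "p x = 0" using A[rule_format, of "x + 2 * i"] by simp
  qed
  then have "finite ((\<lambda>i. texp i p) -` Poly_Mapping.keys (coeffs a))"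
    using assms by (intro finite_vimageI inj_texp) auto
  then show ?thesis by (rule rev_finite_subset) (auto simp: in_keys_iff)
qed simp

definition orb :: "aq \<Rightarrow> (int \<Rightarrow> int) \<Rightarrow> laurent" where
  "orb a p = Sum_any (\<lambda>i::int. coef a (texp i p))"

text \<open>Every shift fixes the zero exponent, so a nonzero constant term makes the support
  infinite, where \<open>Sum_any\<close> takes the value 0. Hence orbit sums carry no information on
  the constant term, and the additivity rules below assume \<open>p \<noteq> 0\<close>.\<close>

lemma orb_zero_exponent [simp]: "orb a 0 = 0"
proof -
  have "{i::int. coef a 0 \<noteq> 0} = (if coef a 0 = 0 then {} else UNIV)" by auto
  then show ?thesis unfolding orb_def by (simp add: Sum_any.expand_set)
qed

lemma orb_add: "p \<noteq> 0 \<Longrightarrow> orb (a + b) p = orb a p + orb b p"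
  unfolding orb_def coeffs_add lookup_add by (intro Sum_any.distrib finite_orbit)

lemma orb_diff: "p \<noteq> 0 \<Longrightarrow> orb (a - b) p = orb a p - orb b p"
  using orb_add[of p "a - b" b] by simp

lemma orb_smult: "p \<noteq> 0 \<Longrightarrow> orb (c *\<^sub>q a) p = c * orb a p"
  unfolding orb_def lookup_coeffs_smult by (simp add: Sum_any_right_distrib finite_orbit)

lemma orb_texp: "orb a (texp j p) = orb a p"
proof -
  have "bij (\<lambda>i. i + j)" by (rule bij_plus_right)
  then show ?thesis unfolding orb_def
    by (rule Sum_any.reindex_cong[symmetric]) (simp add: fun_eq_iff)
qed

lemma orb_uminus: "orb a p = Sum_any (\<lambda>i::int. coef a (texp (- i) p))"
proof -
  have "bij (uminus :: int \<Rightarrow> int)" by (rule bij_uminus)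
  then show ?thesis unfolding orb_def
    by (rule Sum_any.reindex_cong) (simp add: fun_eq_iff)
qed

lemma orb_shift: "orb (shift j a) p = orb a p"
  unfolding orb_def[of "shift j a"] lookup_coeffs_shift
  using orb_texp[of a "- j" p] by (simp add: orb_def add.commute)

lemma orb_nonzeroD:
  assumes "orb a p \<noteq> 0"
  shows "\<exists>i e. coef a e \<noteq> 0 \<and> p = texp i e"
proof -
  obtain i where "coef a (texp i p) \<noteq> 0"
    using assms unfolding orb_def by (rule Sum_any.not_neutral_obtains_not_neutral)
  then show ?thesis by (intro exI[of _ "- i"] exI[of _ "texp i p"]) simp
qed

lemma coef_flow:
  assumes "P \<in> aq_deg 0"
  shows "coef (flow P a) k = Sum_any (\<lambda>i. coef (comm (shift i P) a) k)"
  unfolding flow_def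
  by (rule additive_Sum_any) (simp_all add: coeffs_add lookup_add finite_comm_shift assms)

lemma coef_comm_letter:
  assumes "P \<in> aq_deg 0" "gsgn g = 1"
  shows "coef (comm P (word_aq (Word [g]))) k =
    coef P (k - zexp (gpos g)) * gam (gpos g) (k - zexp (gpos g))"
  using assms(1)
proof (induction rule: aq_deg_induct)
  case (word c u)
  let ?v = "Word [g]"
  have v: "wexp ?v = zexp (gpos g)" using assms(2) by (simp add: fun_eq_iff wexp_Word)
  have "kap (u + ?v) = kap u - wexp u (gpos g)" "kap (?v + u) = kap u - wexp u (gpos g - 1)"
    using assms(2) wpair_swap[of ?v u] word by (simp_all add: kap_plus wpair_Word)
  then have kap: "qpow (kap (u + ?v)) = qpow (kap u) * qpow (- wexp u (gpos g))"
    "qpow (kap (?v + u)) = qpow (kap u) * qpow (- wexp u (gpos g - 1))"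
    by (simp_all flip: qpow_add)
  have comm: "comm (c *\<^sub>q word_aq u) (word_aq ?v) = c *\<^sub>q word_aq (u + ?v) - c *\<^sub>q word_aq (?v + u)"
    by (simp add: comm_def smult_aq_mult word_aq_plus)
  have "wexp u + zexp (gpos g) = k \<longleftrightarrow> wexp u = k - zexp (gpos g)" by (auto simp: algebra_simps)
  then show ?case
    by (cases "wexp u = k - zexp (gpos g)")
      (simp_all only: comm coeffs_diff coeffs_smult_word lookup_minus lookup_single when_def v wexp_plus
        add.commute[of "zexp (gpos g)"] kap gam_def, simp_all add: algebra_simps)
next
  case (add a b)
  then show ?case by (simp add: comm_add coeffs_add lookup_add distrib_right)
qed simp

text \<open>The factor \<open>gam\<close> is the same for all translates of \<open>P\<close>, so the
  coefficients add up to the orbit sum. At exponent 0, where the orbit sum is only a default,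
  \<open>gam\<close> is 0.\<close>

lemma coef_flow_letter:
  assumes "P \<in> aq_deg 0" "gsgn g = 1"
  shows "coef (flow P (word_aq (Word [g]))) k =
    orb P (k - zexp (gpos g)) * gam (gpos g) (k - zexp (gpos g))"
proof (cases "k - zexp (gpos g) = 0")
  case True
  then show ?thesis
    unfolding coef_flow[OF assms(1)] coef_comm_letter[OF shift_aq_deg[OF assms(1)] assms(2)]
    by (simp add: gam_def)
next
  case False
  have "finite {i. coef P (texp (- i) (k - zexp (gpos g))) \<noteq> 0}"
    using finite_vimageI[OF finite_orbit[OF False, of P], of uminus] by (simp add: vimage_def)
  then show ?thesis
    unfolding coef_flow[OF assms(1)] coef_comm_letter[OF shift_aq_deg[OF assms(1)] assms(2)]
      orb_uminus lookup_coeffs_shift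
    by (simp add: Sum_any_left_distrib)
qed

text \<open>Orbit sums do not see \<open>shift 1 R - R\<close>, so the orbit sum of the flow at
  \<open>k\<close> vanishes. Its term at the \<open>i\<close>-th translate of \<open>k\<close> is
  governed by the orbit sum of \<open>P\<close> at \<open>k\<close> with the letter, shifted by
  \<open>- i\<close>, removed.\<close>

lemma screened_orb:
  assumes P: "P \<in> aq_deg 0" and g: "gsgn g = 1" and s: "screened_by n (word_aq (Word [g])) P"
    and k: "k \<noteq> 0" and b: "even (b - gpos g)"
  shows "Sum_any (\<lambda>j. orb P (k - zexp (b + 2 * j)) * gam (b + 2 * j) (k - zexp (b + 2 * j))) = 0"
proof -
  let ?t = "\<lambda>c. orb P (k - zexp c) * gam c (k - zexp c)"
  obtain R where R: "flow P (word_aq (Word [g])) = (qvar - 1) *\<^sub>q (shift 1 R - R)"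
    using s unfolding screened_by_def by blast
  have "0 = orb (flow P (word_aq (Word [g]))) k"
    unfolding R using k by (simp add: orb_smult orb_diff orb_shift)
  also have "\<dots> = Sum_any (\<lambda>i. ?t (gpos g - 2 * i))"
  proof -
    have "coef (flow P (word_aq (Word [g]))) (texp i k) = ?t (gpos g - 2 * i)" for i
    proof -
      have "texp i k - zexp (gpos g) = texp i (k - zexp (gpos g - 2 * i))"
        by (simp add: texp_diff texp_zexp)
      then show ?thesis unfolding coef_flow_letter[OF P g] orb_texp
        by (simp add: orb_texp gam_def texp_def algebra_simps)
    qed
    then show ?thesis unfolding orb_def by simp
  qed
  also have "\<dots> = Sum_any (\<lambda>j. ?t (b + 2 * j))"
  proof -
    obtain d where d: "b = gpos g + 2 * d" using b by (metis add.commute diff_add_cancel dvdE)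
    \<comment> \<open>Term \<open>i\<close> sits at \<open>gpos g - 2 * i\<close> and term
      \<open>j\<close> at \<open>b + 2 * j\<close>; they agree for
      \<open>i = - d - j\<close>.\<close>
    have "bij (\<lambda>j::int. - d - j)"
      by (rule bij_betw_byWitness[of _ "\<lambda>j. - d - j"]) auto
    then show ?thesis
      by (rule Sum_any.reindex_cong) (simp add: fun_eq_iff d algebra_simps)
  qed
  finally show ?thesis by simp
qed

lemma coef_deg_0_finite:
  assumes "P \<in> aq_deg 0" "coef P e \<noteq> 0"
  shows "finite {x. e x \<noteq> 0}"
  using coeffs_aq_deg[OF assms] finite_wexp_iff by auto

lemma finite_texp:
  assumes "finite {x. e x \<noteq> 0}"
  shows "finite {x. texp i e x \<noteq> 0}"
proof -
  have "{x. texp i e x \<noteq> 0} \<subseteq> (\<lambda>x. x + 2 * i) ` {x. e x \<noteq> 0}"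
    by (auto simp: texp_def intro!: image_eqI[of _ _ "_ - 2 * i"])
  then show ?thesis using assms finite_surj by blast
qed

definition integral_density :: "aq \<Rightarrow> bool" where
  "integral_density P \<longleftrightarrow> P \<in> aq_deg 0 \<and> screened_by 1 (xg 0) P \<and> screened_by (- 1) (yg 0) P"

lemma screened_density_orb:
  assumes "integral_density P"
  shows "screened_density (orb P)"
proof
  have P: "P \<in> aq_deg 0" "screened_by 1 (word_aq (Word [X 0])) P" "screened_by (- 1) (word_aq (Word [Y 0])) P"
    using assms by (simp_all add: integral_density_def xg_def yg_def)
  let ?K = "Poly_Mapping.keys (coeffs P)"
  have fin: "finite {x. e x \<noteq> 0}" if "e \<in> ?K" for e
    using that coef_deg_0_finite[OF P(1)] by (simp add: in_keys_iff)
  have "finite (insert 0 (\<Union>e\<in>?K. e ` {x. e x \<noteq> 0}))" using fin by simp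
  then obtain N where N: "\<forall>v\<in>insert 0 (\<Union>e\<in>?K. e ` {x. e x \<noteq> 0}). N \<le> v"
    by (meson bdd_below_finite bdd_below_def)
  have "N \<le> e x" if "e \<in> ?K" for e x
    using N that by (cases "e x = 0") auto
  then show "\<exists>N. \<forall>p a. orb P p \<noteq> 0 \<longrightarrow> N \<le> p a"
    using orb_nonzeroD[of P] by (metis in_keys_iff texp_def)
  have "finite (\<Union>e\<in>?K. {x. e x \<noteq> 0})" using fin by simp
  then obtain A B where AB: "\<forall>x\<in>(\<Union>e\<in>?K. {x. e x \<noteq> 0}). A \<le> x" "\<forall>x\<in>(\<Union>e\<in>?K. {x. e x \<noteq> 0}). x \<le> B"
    by (meson bdd_below_finite bdd_below_def bdd_above_finite bdd_above_def)
  show "\<exists>W. \<forall>p a b. orb P p \<noteq> 0 \<longrightarrow> p a \<noteq> 0 \<longrightarrow> p b \<noteq> 0 \<longrightarrow> b - a \<le> W"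
  proof (intro exI[of _ "B - A"] allI impI)
    fix p a b assume "orb P p \<noteq> 0" and ab: "p a \<noteq> 0" "p b \<noteq> 0"
    then obtain i e where e: "e \<in> ?K" "p = texp i e" using orb_nonzeroD by (metis in_keys_iff)
    then have "A \<le> a - 2 * i" "b - 2 * i \<le> B" using AB ab unfolding texp_def by blast+
    then show "b - a \<le> B - A" by simp
  qed
  show "finite {a. p a \<noteq> 0}" if "orb P p \<noteq> 0" for p
    using orb_nonzeroD[OF that] coef_deg_0_finite[OF P(1)] finite_texp by metis
  fix p :: "int \<Rightarrow> int" and b :: int
  assume p: "finite {a. p a \<noteq> 0}"
  \<comment> \<open>The support of \<open>zexp b\<close> is infinite, so a finitely supported
    \<open>p\<close> cannot cancel it.\<close>
  have "p + zexp b \<noteq> 0"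
  proof
    assume "p + zexp b = 0"
    have "p x \<noteq> 0" if "b \<le> x" for x
      using that fun_cong[OF \<open>p + zexp b = 0\<close>, of x] by (auto simp: zexp_def split: if_splits)
    then have "finite {b..}" using p by (intro finite_subset[OF _ p]) auto
    then show False using infinite_Ici by blast
  qed
  \<comment> \<open>Even \<open>b\<close> uses the charge of \<open>x_0\<close>, odd
    \<open>b\<close> that of \<open>y_0\<close>.\<close>
  then show "Sum_any (\<lambda>j. orb P (p + zexp b - zexp (b + 2 * j)) *
      gam (b + 2 * j) (p + zexp b - zexp (b + 2 * j))) = 0"
    using screened_orb[OF P(1) _ P(2), of "p + zexp b" b] screened_orb[OF P(1) _ P(3), of "p + zexp b" b]
    by (cases "even b") auto
qed simp

section \<open>From vanishing orbit sums to total differences\<close>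

lemma monom_wexp: "coeffs (monom (wexp w)) = Poly_Mapping.single (wexp w) 1" "monom (wexp w) \<in> aq_deg (word_deg w)"
proof -
  have eq: "monom (wexp w) = qpow (- kap w) *\<^sub>q word_aq w"
    unfolding word_aq_monom[of w] by (simp flip: qpow_add)
  show "coeffs (monom (wexp w)) = Poly_Mapping.single (wexp w) 1"
    unfolding eq coeffs_smult_word by (simp flip: qpow_add)
  show "monom (wexp w) \<in> aq_deg (word_deg w)"
    unfolding eq by (intro aq_deg_smult aq_deg_word)
qed

lemma shift_monom: "shift i (monom (wexp w)) = monom (texp i (wexp w))"
proof -
  have "coef (shift i (monom (wexp w))) p = coef (monom (texp i (wexp w))) p" for p
  proof -
    have "wexp w = texp (- i) p \<longleftrightarrow> texp i (wexp w) = p" by auto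
    then show ?thesis
      using monom_wexp(1)[of "shift_word i w"]
      by (simp add: lookup_coeffs_shift monom_wexp wexp_shift lookup_single when_def)
  qed
  then have "coeffs (shift i (monom (wexp w))) = coeffs (monom (texp i (wexp w)))"
    by (rule poly_mapping_eqI)
  then show ?thesis by (simp add: coeffs_inject)
qed

lemma shift_uminus: "shift i (- a) = - shift i a"
  using shift_diff[of i 0 a] by simp

definition total_differences :: "int \<Rightarrow> aq set" where
  "total_differences n = (\<lambda>R. shift 1 R - R) ` aq_deg n"

lemma total_differences_add:
  assumes "a \<in> total_differences n" "b \<in> total_differences n"
  shows "a + b \<in> total_differences n"
proof -
  obtain R S where "R \<in> aq_deg n" "S \<in> aq_deg n" "a = shift 1 R - R" "b = shift 1 S - S"
    using assms unfolding total_differences_def by blast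
  then have "a + b = shift 1 (R + S) - (R + S)" "R + S \<in> aq_deg n"
    by (simp_all add: shift_add aq_deg_add)
  then show ?thesis unfolding total_differences_def by blast
qed

lemma total_differences_uminus:
  assumes "a \<in> total_differences n"
  shows "- a \<in> total_differences n"
proof -
  obtain R where R: "R \<in> aq_deg n" "a = shift 1 R - R"
    using assms unfolding total_differences_def by blast
  then have "- a = shift 1 (- R) - (- R)" "- R \<in> aq_deg n"
    using aq_deg_diff[of 0 n R] by (simp_all add: shift_uminus)
  then show ?thesis unfolding total_differences_def by blast
qed

lemma shift_total_difference:
  assumes "a \<in> aq_deg n"
  shows "shift i a - a \<in> total_differences n"
proof (induction i rule: int_induct[where k = 0])
  case base
  show ?case unfolding total_differences_def by (rule image_eqI[of _ _ 0]) (simp_all add: shift_0)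
next
  case (step1 i)
  have "shift 1 (shift i a) - shift i a \<in> total_differences n"
    unfolding total_differences_def using shift_aq_deg[OF assms] by blast
  from total_differences_add[OF this step1(2)] show ?case by (simp add: shift_shift add.commute)
next
  case (step2 i)
  have "shift 1 (shift (i - 1) a) - shift (i - 1) a \<in> total_differences n"
    unfolding total_differences_def using shift_aq_deg[OF assms] by blast
  from total_differences_add[OF step2(2) total_differences_uminus[OF this]] show ?case
    by (simp add: shift_shift)
qed

text \<open>If all orbit sums vanish, a monomial can be moved along its orbit onto another one that occurs,
  which decreases the number of monomials.\<close>

lemma total_difference_criterion:
  assumes "a \<in> aq_deg n" "\<And>p. p \<noteq> 0 \<Longrightarrow> orb a p = 0" "coef a 0 = 0"
  shows "a \<in> total_differences n"
  using assms
proof (induction "card (Poly_Mapping.keys (coeffs a))" arbitrary: a rule: less_induct)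
  case less
  show ?case
  proof (cases "coeffs a = 0")
    case True
    then have "a = 0" using coeffs_inject[of a 0] by simp
    then show ?thesis unfolding total_differences_def by (auto intro!: image_eqI[of _ _ 0])
  next
    case False
    then obtain p where p: "coef a p \<noteq> 0" by (metis poly_mapping_eqI lookup_zero)
    then have "p \<noteq> 0" using less.prems(3) by auto
    obtain w where w: "wexp w = p" "word_deg w = n" using coeffs_aq_deg[OF less.prems(1) p] by blast
    \<comment> \<open>A nonzero coefficient must be compensated by another one in its orbit.\<close>
    have "\<exists>i. i \<noteq> 0 \<and> coef a (texp i p) \<noteq> 0"
    proof (rule ccontr)
      assume "\<not> ?thesis"
      then have "orb a p = (\<Sum>i\<in>{0}. coef a (texp i p))"
        unfolding orb_def by (intro Sum_any.expand_superset) auto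
      then show False using less.prems(2)[OF \<open>p \<noteq> 0\<close>] p by simp
    qed
    then obtain i where i: "i \<noteq> 0" "coef a (texp i p) \<noteq> 0" by blast
    define m where "m = monom p"
    have m: "m \<in> aq_deg n" using monom_wexp(2)[of w] w m_def by simp
    \<comment> \<open>Subtracting \<open>d\<close> moves the coefficient from \<open>p\<close> to
      \<open>texp i p\<close>, which occurs already, so no new monomial arises.\<close>
    define d where "d = coef a p *\<^sub>q (m - shift i m)"
    obtain A where "\<forall>x<A. p x = 0" using wexp_vanishes_left[of w] w by auto
    then have "texp i p \<noteq> p" using injD[OF inj_texp[OF \<open>p \<noteq> 0\<close>], of A i 0] i by auto
    have coef_m: "coef m r = (if r = p then 1 else 0)" "coef (shift i m) r = (if r = texp i p then 1 else 0)" for r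
      using monom_wexp(1)[of w] monom_wexp(1)[of "shift_word i w"] shift_monom[of i w] w
      by (auto simp: m_def wexp_shift lookup_single when_def)
    have "coef (a - d) r = coef a r - coef a p * (coef m r - coef (shift i m) r)" for r
      by (simp add: d_def coeffs_diff lookup_minus lookup_coeffs_smult)
    note coef_d = this[unfolded coef_m]
    have "Poly_Mapping.keys (coeffs (a - d)) \<subseteq> Poly_Mapping.keys (coeffs a) - {p}"
      using i \<open>texp i p \<noteq> p\<close> by (auto simp: in_keys_iff coef_d split: if_splits)
    moreover have "p \<in> Poly_Mapping.keys (coeffs a)" using p by (simp add: in_keys_iff)
    ultimately have card: "card (Poly_Mapping.keys (coeffs (a - d))) < card (Poly_Mapping.keys (coeffs a))"
      by (intro psubset_card_mono) auto
    have "d = shift i (- coef a p *\<^sub>q m) - (- coef a p *\<^sub>q m)"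
      by (simp add: d_def shift_smult shift_uminus aq.scale_right_diff_distrib)
    then have d: "d \<in> total_differences n"
      using shift_total_difference[OF aq_deg_smult[OF m]] by metis
    have "d \<in> aq_deg n" using m by (simp add: d_def aq_deg_smult aq_deg_diff shift_aq_deg)
    then have "a - d \<in> aq_deg n" using less.prems by (simp add: aq_deg_diff)
    moreover have "orb (a - d) r = 0" if "r \<noteq> 0" for r
      using that less.prems(2)[OF that] by (simp add: orb_diff d_def orb_smult orb_shift)
    moreover have "coef (a - d) 0 = 0"
      using \<open>p \<noteq> 0\<close> less.prems(3) by (auto simp: coef_d texp_def fun_eq_iff) (metis add_diff_cancel_right')
    ultimately have "a - d \<in> total_differences n" using card less.hyps by blast
    from total_differences_add[OF this d] show ?thesis by simp
  qed
qed

section \<open>Brackets of integrals\<close>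

text \<open>For \<open>p\<close> of degree 0, ordering the product of the monomials \<open>p\<close> and \<open>r\<close> produces the power
  \<open>cocycle p r\<close> of \<open>q\<close>.\<close>

definition cocycle :: "(int \<Rightarrow> int) \<Rightarrow> (int \<Rightarrow> int) \<Rightarrow> int" where
  "cocycle p r = Sum_any (\<lambda>a::int. p a * (r a + r (a - 1)))"

lemma cocycle_superset:
  assumes "finite S" "{a. p a \<noteq> 0} \<subseteq> S"
  shows "cocycle p r = (\<Sum>a\<in>S. p a * (r a + r (a - 1)))"
  unfolding cocycle_def using assms by (intro Sum_any.expand_superset) auto

lemma cocycle_diff_right:
  assumes "finite {a. p a \<noteq> 0}"
  shows "cocycle p (r - r') = cocycle p r - cocycle p r'"
  unfolding cocycle_superset[OF assms order_refl] by (simp add: algebra_simps flip: sum_subtractf)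

lemma cocycle_diff_left:
  assumes "finite {a. p a \<noteq> 0}" "finite {a. p' a \<noteq> 0}"
  shows "cocycle (p - p') r = cocycle p r - cocycle p' r"
proof -
  let ?S = "{a. p a \<noteq> 0} \<union> {a. p' a \<noteq> 0}"
  have "cocycle p'' r = (\<Sum>a\<in>?S. p'' a * (r a + r (a - 1)))" if "p'' \<in> {p, p', p - p'}" for p''
    using that assms by (intro cocycle_superset) auto
  then show ?thesis by (simp add: algebra_simps flip: sum_subtractf)
qed

lemma cocycle_zero [simp]: "cocycle 0 r = 0" "cocycle p 0 = 0"
  by (simp_all add: cocycle_def)

text \<open>By \<open>wpair_swap\<close> the correction in \<open>kap_plus\<close> is minus the
  pairing of \<open>wexp u\<close> with the letters of \<open>v\<close>, and the multiplicity of
  \<open>z_a\<close> in \<open>v\<close> is minus the sum of the entries of \<open>wexp v\<close> at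
  \<open>a\<close> and \<open>a - 1\<close>.\<close>

lemma kap_plus_cocycle:
  assumes "word_deg u = 0"
  shows "kap (u + v) = kap u + kap v + cocycle (wexp u) (wexp v)"
proof -
  let ?S = "{a. wexp u a \<noteq> 0}"
  have S: "finite ?S" using assms finite_wexp_iff by blast
  have single: "(\<Sum>a\<in>?S. wexp u a * (zexp b a + zexp b (a - 1))) = - wexp u b" for b
  proof -
    have "zexp b a + zexp b (a - 1) = (if a = b then - 1 else 0)" for a
      by (cases a b rule: linorder_cases) (auto simp: zexp_def)
    then have "wexp u a * (zexp b a + zexp b (a - 1)) = (if a = b then - wexp u b else 0)" for a
      by simp
    then show ?thesis using S by (simp only: sum.delta) simp
  qed
  have "cocycle (wexp u) (wexp (Word xs)) = - wpair (wexp u) (Word xs)" for xs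
  proof (induction xs)
    case Nil
    then show ?case by (simp add: cocycle_def wexp_Word wpair_Word)
  next
    case (Cons g xs)
    have "cocycle (wexp u) (wexp (Word (g # xs))) =
        gsgn g * (\<Sum>a\<in>?S. wexp u a * (zexp (gpos g) a + zexp (gpos g) (a - 1))) + cocycle (wexp u) (wexp (Word xs))"
      unfolding cocycle_superset[OF S order_refl] wexp_Word
      by (simp add: sum_distrib_left algebra_simps flip: sum.distrib)
    then show ?case using Cons by (simp only: single) (simp add: wpair_Word)
  qed
  from this[of "letters v"] show ?thesis
    using assms by (simp add: kap_plus wpair_swap)
qed

definition gam2 :: "(int \<Rightarrow> int) \<Rightarrow> (int \<Rightarrow> int) \<Rightarrow> laurent" where
  "gam2 p r = qpow (cocycle p r) - qpow (cocycle r p)"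

lemma gam2_zero [simp]: "gam2 0 r = 0" "gam2 p 0 = 0"
  by (simp_all add: gam2_def)

lemma coef_comm:
  assumes "P \<in> aq_deg 0" "Q \<in> aq_deg 0"
  shows "coef (comm P Q) k = Sum_any (\<lambda>r. coef P (k - r) * gam2 (k - r) r * coef Q r)"
proof -
  have fin: "finite {r. coef A (k - r) * gam2 (k - r) r * coef B r \<noteq> 0}" for A B
    by (rule finite_subset[of _ "Poly_Mapping.keys (coeffs B)"]) (auto simp: in_keys_iff)
  show ?thesis using assms(1)
  proof (induction rule: aq_deg_induct)
    case (word c u)
    show ?case using assms(2)
    proof (induction rule: aq_deg_induct)
      case (word d v)
      let ?f = "\<lambda>r. coef (c *\<^sub>q word_aq u) (k - r) * gam2 (k - r) r * coef (d *\<^sub>q word_aq v) r"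
      have "kap (u + v) = kap u + kap v + cocycle (wexp u) (wexp v)"
        "kap (v + u) = kap u + kap v + cocycle (wexp v) (wexp u)"
        using kap_plus_cocycle \<open>word_deg u = 0\<close> word by auto
      then have kap: "qpow (kap (u + v)) = qpow (kap u) * qpow (kap v) * qpow (cocycle (wexp u) (wexp v))"
        "qpow (kap (v + u)) = qpow (kap u) * qpow (kap v) * qpow (cocycle (wexp v) (wexp u))"
        by (simp_all add: qpow_add)
      have comm: "comm (c *\<^sub>q word_aq u) (d *\<^sub>q word_aq v) = (c * d) *\<^sub>q word_aq (u + v) - (c * d) *\<^sub>q word_aq (v + u)"
        by (simp add: comm_smult) (simp add: comm_def word_aq_plus aq.scale_right_diff_distrib mult.commute[of d])
      have "Sum_any ?f = sum ?f {wexp v}"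
        by (rule Sum_any.expand_superset) (auto simp: coeffs_smult_word lookup_single when_def)
      moreover have "wexp u + wexp v = k \<longleftrightarrow> wexp u = k - wexp v" by (auto simp: algebra_simps)
      ultimately show ?case
        by (cases "wexp u = k - wexp v")
          (simp_all only: comm coeffs_diff coeffs_smult_word lookup_minus lookup_single when_def wexp_plus
            add.commute[of "wexp v"] kap gam2_def, simp_all add: algebra_simps)
    next
      case (add Q Q')
      then show ?case
        by (simp only: comm_add coeffs_add lookup_add distrib_left Sum_any.distrib[OF fin fin])
    qed simp
  next
    case (add P P')
    then show ?case
      by (simp only: comm_add coeffs_add lookup_add distrib_right Sum_any.distrib[OF fin fin])
  qed simp
qed

lemma coef_flow_deg_0:
  assumes "P \<in> aq_deg 0" "Q \<in> aq_deg 0"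
  shows "coef (flow P Q) k = Sum_any (\<lambda>r. orb P (k - r) * gam2 (k - r) r * coef Q r)"
proof -
  let ?K = "Poly_Mapping.keys (coeffs Q)"
  have fin: "finite {i. coef P (texp (- i) (k - r)) * gam2 (k - r) r * coef Q r \<noteq> 0}" for r
  proof (cases "k - r = 0")
    case False
    have "finite {i. coef P (texp (- i) (k - r)) \<noteq> 0}"
      using finite_vimageI[OF finite_orbit[OF False, of P], of uminus] by (simp add: vimage_def)
    then show ?thesis by (rule rev_finite_subset) auto
  qed simp
  have "coef (flow P Q) k = Sum_any (\<lambda>i. \<Sum>r\<in>?K. coef P (texp (- i) (k - r)) * gam2 (k - r) r * coef Q r)"
    unfolding coef_flow[OF assms(1)] coef_comm[OF shift_aq_deg[OF assms(1)] assms(2)] lookup_coeffs_shift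
    by (intro Sum_any.cong Sum_any.expand_superset) (auto simp: in_keys_iff)
  also have "\<dots> = (\<Sum>r\<in>?K. Sum_any (\<lambda>i. coef P (texp (- i) (k - r)) * gam2 (k - r) r * coef Q r))"
  proof -
    have "Sum_any (\<lambda>i. \<Sum>r\<in>S. coef P (texp (- i) (k - r)) * gam2 (k - r) r * coef Q r) =
        (\<Sum>r\<in>S. Sum_any (\<lambda>i. coef P (texp (- i) (k - r)) * gam2 (k - r) r * coef Q r))"
      if "finite S" for S
      using that
    proof induction
      case (insert r S)
      have finS: "finite {i. (\<Sum>r\<in>S. coef P (texp (- i) (k - r)) * gam2 (k - r) r * coef Q r) \<noteq> 0}"
      proof (rule finite_subset)
        show "{i. (\<Sum>r\<in>S. coef P (texp (- i) (k - r)) * gam2 (k - r) r * coef Q r) \<noteq> 0} \<subseteq>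
            (\<Union>r\<in>S. {i. coef P (texp (- i) (k - r)) * gam2 (k - r) r * coef Q r \<noteq> 0})"
          by (auto simp del: mult_eq_0_iff elim!: sum.not_neutral_contains_not_neutral)
        show "finite (\<Union>r\<in>S. {i. coef P (texp (- i) (k - r)) * gam2 (k - r) r * coef Q r \<noteq> 0})"
          using insert(1) fin by blast
      qed
      show ?case by (simp only: sum.insert[OF insert(1,2)] Sum_any.distrib[OF fin finS] insert.IH)
    qed simp
    then show ?thesis by simp
  qed
  also have "\<dots> = (\<Sum>r\<in>?K. orb P (k - r) * gam2 (k - r) r * coef Q r)"
  proof (rule sum.cong)
    fix r
    show "Sum_any (\<lambda>i. coef P (texp (- i) (k - r)) * gam2 (k - r) r * coef Q r) =
        orb P (k - r) * gam2 (k - r) r * coef Q r"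
    proof (cases "k - r = 0")
      case False
      have "finite {i. coef P (texp (- i) (k - r)) \<noteq> 0}"
        using finite_vimageI[OF finite_orbit[OF False, of P], of uminus] by (simp add: vimage_def)
      then show ?thesis unfolding orb_uminus by (simp add: Sum_any_left_distrib mult.assoc)
    qed simp
  qed simp
  also have "\<dots> = Sum_any (\<lambda>r. orb P (k - r) * gam2 (k - r) r * coef Q r)"
    by (rule Sum_any.expand_superset[symmetric]) (auto simp: in_keys_iff)
  finally show ?thesis .
qed

lemma cocycle_texp: "cocycle (texp i p) (texp i r) = cocycle p r"
proof -
  have "bij (\<lambda>a. a - 2 * i)" by (rule bij_betw_byWitness[of _ "\<lambda>a. a + 2 * i"]) auto
  then show ?thesis unfolding cocycle_def
    by (rule Sum_any.reindex_cong[symmetric]) (simp add: fun_eq_iff texp_def algebra_simps)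
qed

lemma gam2_texp: "gam2 (texp i p) (texp i r) = gam2 p r"
  by (simp add: gam2_def cocycle_texp)

text \<open>This permits the exchange of sums in \<open>orb_flow\<close>. A translate of a monomial
  of \<open>P\<close> that fails to commute with its complement in \<open>wexp w\<close> also fails
  to commute with \<open>w\<close> itself, and \<open>finite_comm_shift\<close> leaves finitely many
  of those.\<close>

lemma finite_overlapping:
  assumes P: "P \<in> aq_deg 0" and w: "word_deg w = 0"
  shows "finite {r. orb P (wexp w - r) * gam2 (wexp w - r) r \<noteq> 0}"
proof -
  let ?K = "Poly_Mapping.keys (coeffs P)"
  let ?I = "\<lambda>e. {i. comm (shift i (monom e)) (word_aq w) \<noteq> 0}"
  have K: "\<exists>u. wexp u = e \<and> word_deg u = 0" if "e \<in> ?K" for e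
    using that coeffs_aq_deg[OF P] by (simp add: in_keys_iff)
  have "{r. orb P (wexp w - r) * gam2 (wexp w - r) r \<noteq> 0} \<subseteq> (\<Union>e\<in>?K. (\<lambda>i. wexp w - texp i e) ` ?I e)"
  proof
    fix r assume r: "r \<in> {r. orb P (wexp w - r) * gam2 (wexp w - r) r \<noteq> 0}"
    define p where "p = wexp w - r"
    have r_eq: "r = wexp w - p" by (simp add: p_def)
    have p: "orb P p \<noteq> 0" "gam2 p (wexp w - p) \<noteq> 0" using r unfolding r_eq by auto
    obtain i e where e: "e \<in> ?K" "p = texp i e" using orb_nonzeroD[OF p(1)] by (auto simp: in_keys_iff)
    obtain u where u: "wexp u = e" "word_deg u = 0" using K[OF e(1)] by blast
    define v where "v = shift_word i u"
    have v: "wexp v = p" "word_deg v = 0" using u e by (simp_all add: v_def wexp_shift word_deg_shift)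
    have fin: "finite {a. p a \<noteq> 0}" "finite {a. wexp w a \<noteq> 0}" using v w finite_wexp_iff by blast+
    \<comment> \<open>The contribution \<open>cocycle p p\<close> of the complement is the same in
      both orders and drops out.\<close>
    have "cocycle p (wexp w) \<noteq> cocycle (wexp w) p"
      using p(2) cocycle_diff_right[OF fin(1)] cocycle_diff_left[OF fin(2,1)] by (auto simp: gam2_def)
    then have "kap (v + w) \<noteq> kap (w + v)" using v w by (simp add: kap_plus_cocycle)
    then have "coef (comm (word_aq v) (word_aq w)) (wexp (v + w)) \<noteq> 0"
      by (simp add: comm_word lookup_coeffs_smult monom_wexp(1) del: wexp_plus)
    moreover have "word_aq v = qpow (kap v) *\<^sub>q shift i (monom e)"
      using u shift_monom[of i u] by (simp add: word_aq_monom[of v] v e)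
    ultimately have "i \<in> ?I e" by (auto simp: comm_smult)
    then show "r \<in> (\<Union>e\<in>?K. (\<lambda>i. wexp w - texp i e) ` ?I e)" using e r_eq by blast
  qed
  moreover have "finite (?I e)" if "e \<in> ?K" for e
    using K[OF that] monom_wexp(2) by (metis finite_comm_shift)
  then have "finite (\<Union>e\<in>?K. (\<lambda>i. wexp w - texp i e) ` ?I e)" by (intro finite_UN_I) auto
  ultimately show ?thesis by (rule finite_subset)
qed

lemma orb_flow:
  assumes P: "P \<in> aq_deg 0" and Q: "Q \<in> aq_deg 0" and w: "word_deg w = 0" "wexp w = k"
  shows "orb (flow P Q) k = Sum_any (\<lambda>r. orb P (k - r) * gam2 (k - r) r * orb Q r)"
proof -
  let ?t = "\<lambda>r. orb P (k - r) * gam2 (k - r) r"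
  let ?T = "{r. ?t r \<noteq> 0}"
  have T: "finite ?T" using finite_overlapping[OF P w(1)] w(2) by simp
  have zero: "?t 0 = 0" by simp
  let ?I = "\<Union>r\<in>?T. {i. coef Q (texp i r) \<noteq> 0}"
  have I: "finite ?I"
    using T zero by (intro finite_UN_I finite_orbit) auto
  have "orb (flow P Q) k = Sum_any (\<lambda>i. Sum_any (\<lambda>r. ?t r * coef Q (texp i r)))"
    unfolding orb_def[of "flow P Q"] coef_flow_deg_0[OF P Q]
  proof (rule Sum_any.cong)
    fix i
    \<comment> \<open>Substituting \<open>texp i r\<close> for \<open>r\<close> leaves the factor of
      \<open>P\<close> unchanged, by shift invariance, and puts the whole shift on the coefficient
      of \<open>Q\<close>.\<close>
    have "bij (texp i)" by (rule bij_betw_byWitness[of _ "texp (- i)"]) auto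
    then show "Sum_any (\<lambda>r. orb P (texp i k - r) * gam2 (texp i k - r) r * coef Q r) =
        Sum_any (\<lambda>r. ?t r * coef Q (texp i r))"
      by (rule Sum_any.reindex_cong)
        (simp add: fun_eq_iff[where f = "_ \<circ> _"] orb_texp gam2_texp flip: texp_diff)
  qed
  also have "\<dots> = Sum_any (\<lambda>r. Sum_any (\<lambda>i. ?t r * coef Q (texp i r)))"
    by (rule Sum_any.swap[of "?I \<times> ?T"]) (use T I in auto)
  also have "\<dots> = Sum_any (\<lambda>r. ?t r * orb Q r)"
  proof (rule Sum_any.cong)
    fix r
    show "Sum_any (\<lambda>i. ?t r * coef Q (texp i r)) = ?t r * orb Q r"
    proof (cases "r = 0")
      case False
      then show ?thesis unfolding orb_def[of Q] by (simp add: Sum_any_right_distrib finite_orbit)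
    qed simp
  qed
  finally show ?thesis .
qed

text \<open>The entries are 0 or 1, and \<open>connected\<close> allows no gap between
  \<open>a\<close> and the last nonzero entry.\<close>

lemma (in screened_density) prefix_block:
  assumes h: "h p \<noteq> 0" and le: "\<And>x. p x \<le> block a b x" and a: "p a = 1"
  shows "\<exists>c. a \<le> c \<and> c \<le> b \<and> p = block a c"
proof -
  have le_b: "x \<le> b" if "p x \<noteq> 0" for x
    using that le[of x] nonneg[OF h, of x] by (auto simp: block_def split: if_splits)
  have "\<exists>c. p c \<noteq> 0 \<and> (\<forall>x. p x \<noteq> 0 \<longrightarrow> x \<le> c)"
    by (rule int_valued_maximizer[where N = b]) (use a le_b in \<open>auto intro: exI[of _ a]\<close>)
  then obtain c where c: "p c \<noteq> 0" "\<And>x. p x \<noteq> 0 \<Longrightarrow> x \<le> c" by blast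
  have "a \<le> c" using c(2)[of a] a by simp
  have "p x = block a c x" for x
  proof (cases "a \<le> x \<and> x \<le> c")
    case True
    have "0 < p x"
    proof (cases "x = a \<or> x = c")
      case True
      then show ?thesis using a c(1) nonneg[OF h, of c] by auto
    next
      case False
      then show ?thesis
        using True a c(1) nonneg[OF h, of c] by (intro connected[OF h, of a x c]) auto
    qed
    then show ?thesis using le[of x] True by (auto simp: block_def split: if_splits)
  next
    case False
    then show ?thesis
      using c(2)[of x] le[of x] nonneg[OF h, of x] by (auto simp: block_def split: if_splits)
  qed
  then show ?thesis using \<open>a \<le> c\<close> le_b c(1) by blast
qed

text \<open>The cocycle pairs entry \<open>x\<close> of its first argument with entries
  \<open>x\<close> and \<open>x - 1\<close> of its second. So of two adjacent blocks only the right
  one, as first argument, sees the other, and only once, at \<open>c + 1\<close>.\<close>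

lemma gam2_blocks:
  assumes "a \<le> c" "c < b"
  shows "gam2 (block a c) (block (c + 1) b) = 1 - qpow 1"
    "gam2 (block (c + 1) b) (block a c) = - (1 - qpow 1)"
proof -
  have 1: "cocycle (block a c) (block (c + 1) b) = 0"
    by (subst cocycle_superset[of "{a..c}"]) (auto simp: block_def)
  have "cocycle (block (c + 1) b) (block a c) =
      (\<Sum>x\<in>{c + 1..b}. block (c + 1) b x * (block a c x + block a c (x - 1)))"
    by (rule cocycle_superset) (auto simp: block_def)
  also have "\<dots> = (\<Sum>x\<in>{c + 1..b}. if x = c + 1 then 1 else 0)"
    using assms by (intro sum.cong) (auto simp: block_def)
  finally have 2: "cocycle (block (c + 1) b) (block a c) = 1" using assms by simp
  show "gam2 (block a c) (block (c + 1) b) = 1 - qpow 1"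
    "gam2 (block (c + 1) b) (block a c) = - (1 - qpow 1)"
    unfolding gam2_def 1 2 by simp_all
qed

lemma block_minus:
  assumes "a \<le> c" "c \<le> b"
  shows "block a b - block a c = block (c + 1) b" "block a b - block (c + 1) b = block a c"
  using assms by (auto simp: block_def fun_eq_iff)

text \<open>A block splits into two nonempty connected parts only as a prefix and a suffix, and the
  two orders of the parts contribute opposite terms.\<close>

lemma block_product_zero:
  assumes "screened_density f" "screened_density g" "a \<le> b"
  shows "Sum_any (\<lambda>r. f (block a b - r) * gam2 (block a b - r) r * g r) = 0"
proof -
  interpret f: screened_density f by fact
  interpret g: screened_density g by fact
  let ?t = "\<lambda>r. f (block a b - r) * gam2 (block a b - r) r * g r"
  let ?V = "block a ` {a..<b}" and ?W = "(\<lambda>c. block (c + 1) b) ` {a..<b}"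
  have "{r. ?t r \<noteq> 0} \<subseteq> ?V \<union> ?W"
  proof
    fix r assume "r \<in> {r. ?t r \<noteq> 0}"
    then have r: "f (block a b - r) \<noteq> 0" "gam2 (block a b - r) r \<noteq> 0" "g r \<noteq> 0" by auto
    have bounds: "0 \<le> r x" "r x \<le> block a b x" for x
      using f.nonneg[OF r(1), of x] g.nonneg[OF r(3), of x] by auto
    \<comment> \<open>Entry \<open>a\<close> decides whether \<open>r\<close> or its complement is
      the prefix. Neither part can be empty, because \<open>gam2\<close> vanishes at 0.\<close>
    have "r a = 1 \<or> r a = 0" using bounds[of a] assms(3) by (auto simp: block_def)
    then show "r \<in> ?V \<union> ?W"
    proof
      assume "r a = 1"
      then obtain c where c: "a \<le> c" "c \<le> b" "r = block a c"
        using g.prefix_block[OF r(3) bounds(2)] by blast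
      have "c \<noteq> b" using r(2) c(3) by auto
      then show ?thesis using c by auto
    next
      assume "r a = 0"
      then have "(block a b - r) a = 1" "\<And>x. (block a b - r) x \<le> block a b x"
        using bounds assms(3) by (auto simp: block_def)
      then obtain c where c: "a \<le> c" "c \<le> b" "block a b - r = block a c"
        using f.prefix_block[OF r(1)] by blast
      have "r = block a b - (block a b - r)" by simp
      then have r_eq: "r = block a b - block a c" unfolding c(3) .
      then have "c \<noteq> b" using r(2) by auto
      then show ?thesis using c r_eq block_minus(1)[OF c(1,2)] by auto
    qed
  qed
  then have "Sum_any ?t = sum ?t (?V \<union> ?W)" by (intro Sum_any.expand_superset) auto
  also have "\<dots> = sum ?t ?V + sum ?t ?W"
  proof (rule sum.union_disjoint)
    show "?V \<inter> ?W = {}"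
    proof (rule ccontr)
      assume "?V \<inter> ?W \<noteq> {}"
      then obtain c d where cd: "c \<in> {a..<b}" "d \<in> {a..<b}" "block a c = block (d + 1) b" by blast
      show False using fun_cong[OF cd(3), of a] cd(1,2) by (simp add: block_def)
    qed
  qed auto
  also have "sum ?t ?V = (\<Sum>c\<in>{a..<b}. ?t (block a c))"
  proof (rule sum.reindex_cong[OF _ refl])
    show "inj_on (block a) {a..<b}"
    proof (rule inj_onI)
      fix c d assume cd: "c \<in> {a..<b}" "d \<in> {a..<b}" "block a c = block a d"
      show "c = d"
        using fun_cong[OF cd(3), of c] fun_cong[OF cd(3), of d] cd(1,2)
        by (auto simp: block_def split: if_splits)
    qed
  qed simp
  \<comment> \<open>By translation invariance only the lengths of the two parts matter.\<close>
  also have "\<dots> = (\<Sum>c\<in>{a..<b}. - (1 - qpow 1) * (f (block 0 (b - c - 1)) * g (block 0 (c - a))))"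
  proof (rule sum.cong)
    fix c assume c: "c \<in> {a..<b}"
    then have "f (block (c + 1) b) = f (block 0 (b - c - 1))" "g (block a c) = g (block 0 (c - a))"
      using f.block_translate[of 0 "b - c - 1" "c + 1"] g.block_translate[of 0 "c - a" a]
      by (simp_all add: algebra_simps)
    then show "?t (block a c) = - (1 - qpow 1) * (f (block 0 (b - c - 1)) * g (block 0 (c - a)))"
      using c by (simp only: block_minus(1) gam2_blocks atLeastLessThan_iff less_imp_le) (simp only: ac_simps)
  qed simp
  \<comment> \<open>The reflection \<open>c\<close> to \<open>a + b - 1 - c\<close> exchanges the
    lengths of prefix and suffix.\<close>
  also have "\<dots> = (\<Sum>c\<in>{a..<b}. - (1 - qpow 1) * (f (block 0 (c - a)) * g (block 0 (b - c - 1))))"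
    by (rule sum.reindex_bij_witness[of _ "\<lambda>c. a + b - 1 - c" "\<lambda>c. a + b - 1 - c"]) (auto simp: algebra_simps)
  also have "sum ?t ?W = (\<Sum>c\<in>{a..<b}. ?t (block (c + 1) b))"
  proof (rule sum.reindex_cong[OF _ refl])
    show "inj_on (\<lambda>c. block (c + 1) b) {a..<b}"
    proof (rule inj_onI)
      fix c d assume cd: "c \<in> {a..<b}" "d \<in> {a..<b}" "block (c + 1) b = block (d + 1) b"
      show "c = d"
        using fun_cong[OF cd(3), of "c + 1"] fun_cong[OF cd(3), of "d + 1"] cd(1,2)
        by (auto simp: block_def split: if_splits)
    qed
  qed simp
  also have "\<dots> = (\<Sum>c\<in>{a..<b}. (1 - qpow 1) * (f (block 0 (c - a)) * g (block 0 (b - c - 1))))"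
  proof (rule sum.cong)
    fix c assume c: "c \<in> {a..<b}"
    then have "g (block (c + 1) b) = g (block 0 (b - c - 1))" "f (block a c) = f (block 0 (c - a))"
      using g.block_translate[of 0 "b - c - 1" "c + 1"] f.block_translate[of 0 "c - a" a]
      by (simp_all add: algebra_simps)
    then show "?t (block (c + 1) b) = (1 - qpow 1) * (f (block 0 (c - a)) * g (block 0 (b - c - 1)))"
      using c by (simp only: block_minus(2) gam2_blocks atLeastLessThan_iff less_imp_le) (simp only: ac_simps)
  qed simp
  finally have sums: "Sum_any ?t = (\<Sum>c\<in>{a..<b}. - (1 - qpow 1) * (f (block 0 (c - a)) * g (block 0 (b - c - 1)))) +
      (\<Sum>c\<in>{a..<b}. (1 - qpow 1) * (f (block 0 (c - a)) * g (block 0 (b - c - 1))))" .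
  show ?thesis unfolding sums sum.distrib[symmetric] distrib_right[symmetric] by simp
qed

lemma bracket_rep_trivial:
  assumes P: "integral_density P" and Q: "integral_density Q"
  shows "bracket_rep P Q \<in> total_differences 0"
proof -
  have deg: "P \<in> aq_deg 0" "Q \<in> aq_deg 0" using P Q by (simp_all add: integral_density_def)
  define K where "K = bracket_rep P Q"
  have K: "K \<in> aq_deg 0" "(qvar - 1) *\<^sub>q K = flow P Q" using deg by (simp_all add: K_def bracket_rep)
  have "integral_density K"
    using P Q K(1) by (auto simp: integral_density_def K_def intro: screened_by_bracket_rep)
  then interpret screened_density "orb K" by (rule screened_density_orb)
  have block_0: "orb K (block a b) = 0" if "a \<le> b" for a b
  proof (rule ccontr)
    assume nz: "orb K (block a b) \<noteq> 0"
    \<comment> \<open>A word with exponent \<open>block a b\<close>, as required by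
      \<open>orb_flow\<close>, is supplied by the orbit sum assumed to be nonzero.\<close>
    then obtain i e where e: "coef K e \<noteq> 0" "block a b = texp i e" using orb_nonzeroD by blast
    then obtain w where "wexp w = e" "word_deg w = 0" using coeffs_aq_deg[OF K(1)] by blast
    then have w: "wexp (shift_word i w) = block a b" "word_deg (shift_word i w) = 0"
      by (simp_all add: wexp_shift e word_deg_shift)
    have "block a b a \<noteq> 0" using that by (simp add: block_def)
    then have "block a b \<noteq> 0" by (metis zero_fun_apply)
    then have "(qvar - 1) * orb K (block a b) = orb (flow P Q) (block a b)"
      by (simp add: orb_smult flip: K(2))
    also have "\<dots> = 0"
      unfolding orb_flow[OF deg w(2,1)]
      by (rule block_product_zero[OF screened_density_orb[OF P] screened_density_orb[OF Q] that])
    finally show False using nz qvar_minus_1_nonzero by simp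
  qed
  have "orb K p = 0" for p using exists_block[of p] block_0 by blast
  moreover have "coef K 0 = 0"
  proof -
    \<comment> \<open>At exponent 0 the two factors are inverse monomials up to a power of
      \<open>q\<close>, and these commute.\<close>
    have "orb P (0 - r) * gam2 (0 - r) r * coef Q r = 0" for r
    proof (cases "coef Q r = 0")
      case False
      then have fin: "finite {a. r a \<noteq> 0}" by (rule coef_deg_0_finite[OF deg(2)])
      have "cocycle (0 - r) r = cocycle r (0 - r)"
        using cocycle_diff_left[of 0 r r] cocycle_diff_right[OF fin, of 0 r] fin by simp
      then show ?thesis by (simp add: gam2_def)
    qed simp
    then have "(qvar - 1) * coef K 0 = 0"
      unfolding lookup_coeffs_smult[symmetric] K(2) coef_flow_deg_0[OF deg] by simp
    then show ?thesis using qvar_minus_1_nonzero by simp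
  qed
  ultimately show ?thesis
    using total_difference_criterion[OF K(1)] unfolding K_def by blast
qed

section \<open>Integrals of motion as classes of screened densities\<close>

lemma local_ims_iff: "U \<in> local_ims \<longleftrightarrow> (\<exists>P. integral_density P \<and> U = cls 0 P)"
proof -
  have gens: "xg 0 \<in> aq_deg 1" "yg 0 \<in> aq_deg (- 1)"
    using aq_deg_word[of "Word [X 0]"] aq_deg_word[of "Word [Y 0]"]
    by (simp_all add: xg_def yg_def word_deg_def)
  \<comment> \<open>The equivalence holds for every representative, so being an integral density
    depends only on the class.\<close>
  have "cls 0 P \<in> local_ims \<longleftrightarrow> integral_density P" if "P \<in> aq_deg 0" for P
    using that gens bracket_cls_eq_0[of P "xg 0" 1] bracket_cls_eq_0[of P "yg 0" "- 1"]
    by (simp add: local_ims_def screening_plus_def screening_minus_def integral_density_def Floc_cls)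
  moreover have "U \<in> local_ims \<Longrightarrow> U \<in> Floc 0" by (simp add: local_ims_def)
  ultimately show ?thesis by (metis Floc_obtain integral_density_def)
qed

lemma integral_density_0: "integral_density 0"
  by (auto simp: integral_density_def screened_by_def intro!: bexI[of _ 0])

theorem proposition4:
  shows "lie_subalgebra local_ims \<and>
    (\<forall>U\<in>local_ims. \<forall>V\<in>local_ims. bracket 0 U V = cls 0 0)"
proof -
  have bracket_0: "bracket 0 U V = cls 0 0" if UV: "U \<in> local_ims" "V \<in> local_ims" for U V
  proof -
    obtain P Q where PQ: "integral_density P" "U = cls 0 P" "integral_density Q" "V = cls 0 Q"
      using UV unfolding local_ims_iff by blast
    then have "P \<in> aq_deg 0" "Q \<in> aq_deg 0" by (simp_all add: integral_density_def)
    then show ?thesis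
      using bracket_rep_trivial[OF PQ(1,3)] bracket_rep(2)[of P Q 0]
      by (auto simp: PQ bracket_cls cls_eq_iff total_differences_def)
  qed
  have zero: "cls 0 0 \<in> local_ims" using integral_density_0 local_ims_iff by blast
  have "add_Floc 0 U V \<in> local_ims" if UV: "U \<in> local_ims" "V \<in> local_ims" for U V
  proof -
    obtain P Q where PQ: "integral_density P" "U = cls 0 P" "integral_density Q" "V = cls 0 Q"
      using UV unfolding local_ims_iff by blast
    then have "integral_density (P + Q)" "add_Floc 0 U V = cls 0 (P + Q)"
      by (auto simp: integral_density_def add_Floc_cls aq_deg_add intro: screened_by_add)
    then show ?thesis unfolding local_ims_iff by blast
  qed
  moreover have "smult_Floc 0 c U \<in> local_ims" if "U \<in> local_ims" for c U
  proof -
    obtain P where P: "integral_density P" "U = cls 0 P"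
      using \<open>U \<in> local_ims\<close> unfolding local_ims_iff by blast
    then have "integral_density (c *\<^sub>q P)" "smult_Floc 0 c U = cls 0 (c *\<^sub>q P)"
      by (auto simp: integral_density_def smult_Floc_cls aq_deg_smult intro: screened_by_smult)
    then show ?thesis unfolding local_ims_iff by blast
  qed
  moreover have "local_ims \<subseteq> Floc 0" by (auto simp: local_ims_def)
  ultimately show ?thesis
    unfolding lie_subalgebra_def using zero bracket_0 by simp
qed

end
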